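(* Let $\delta_0>0$ and let $\psi$ be a positive function on the interval $(0,\delta_0)$ with $\lim_{\delta\to+0}\psi(\delta)/\delta=+\infty$. Then there exists a strictly increasing bounded sequence of real numbers $a_1<a_2<\ldots$ such that the set $$ E=\{a_k\}_{k=1}^\infty\cup\Big\{\lim_{k\to\infty}a_k\Big\} $$ satisfies the following conditions: 1) $E$ is porous; 2) $|(E)_\delta|\le\psi(\delta)$ for all sufficiently small $\delta>0$; 3) $E$ has property $\mathrm{LP}(p)$ for no $p\in(1,\infty)$ with $p\neq 2$.
   Context: Property $\mathrm{LP}(p)$. Let $E\subseteq\mathbb R$ be a closed set of Lebesgue measure zero, and let $I_k$, $k=1,2,\ldots$, be the intervals complementary to $E$, i.e. the (finitely or countably many) connected components of $\mathbb R\setminus E$ (unbounded components included). Let $S_k$ be the operator defined by $\widehat{S_kf}=1_{I_k}\cdot\widehat f$ for $f\in L^2\cap L^p(\mathbb R)$, where $1_{I_k}$ is the characteristic function of $I_k$ and $\widehat{\ }$ is the Fourier transform (extended to $L^p(\mathbb R)$ by density). Put $S(f)=\left(\sum_k|S_kf|^2\right)^{1/2}$. For $1<p<\infty$, the set $E$ has property $\mathrm{LP}(p)$ if there are positive constants $c_1,c_2$ independent of $f$ such that $c_1\|f\|_{L^p(\mathbb R)}\le\|S(f)\|_{L^p(\mathbb R)}\le c_2\|f\|_{L^p(\mathbb R)}$ for all $f\in L^p(\mathbb R)$. Porosity. A set $F\subseteq\mathbb R$ is porous if there exists a constant $c>0$ such that every bounded interval $I\subseteq\mathbb R$ of positive length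 contains a subinterval $J$ with $|J|\ge c|I|$ and $J\cap F=\varnothing$. Notation. For $F\subseteq\mathbb R$ and $\delta>0$, $(F)_\delta$ is the open $\delta$-neighbourhood of $F$, and $|F|$ is the Lebesgue measure of a measurable set $F$. *)

theory Defs
  imports "HOL-Analysis.Analysis"
begin

text \<open>Real powers and \<open>L\<^sup>p\<close> norms take values in \<open>[0,\<infinity>]\<close>, so that the norm of a square
  function that is infinite on a large set is \<open>\<infinity>\<close>. The exponents used below are positive.\<close>

definition epowr :: "ennreal \<Rightarrow> real \<Rightarrow> ennreal" where
  "epowr x a = (if x = \<infinity> then \<infinity> else ennreal (enn2real x powr a))"

definition Lp_enorm :: "real \<Rightarrow> (real \<Rightarrow> ennreal) \<Rightarrow> ennreal" where
  "Lp_enorm p F = epowr (\<integral>\<^sup>+x. epowr (F x) p \<partial>lborel) (1 / p)"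

definition Lp_norm :: "real \<Rightarrow> (real \<Rightarrow> complex) \<Rightarrow> ennreal" where
  "Lp_norm p f = Lp_enorm p (\<lambda>x. ennreal (norm (f x)))"

text \<open>Elements of \<open>L\<^sup>p\<close> are given by Borel representatives; every notion below is invariant
  under changes on null sets.\<close>

definition Lp_space :: "real \<Rightarrow> (real \<Rightarrow> complex) set" where
  "Lp_space p = {f \<in> borel_measurable lborel. Lp_norm p f < \<infinity>}"

definition Lp_tendsto :: "real \<Rightarrow> (nat \<Rightarrow> real \<Rightarrow> complex) \<Rightarrow> (real \<Rightarrow> complex) \<Rightarrow> bool" where
  "Lp_tendsto p \<phi> f \<longleftrightarrow> (\<lambda>n. Lp_norm p (\<lambda>x. \<phi> n x - f x)) \<longlonglongrightarrow> 0"

text \<open>Normalization \<open>\<integral> f(x) e\<^bsup>-ix\<xi>\<^esup> dx\<close>. A constant factor does not affect the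
  operators \<open>S\<^sub>k\<close>, and rescaling the frequency only dilates \<open>E\<close>, which does not affect
  property LP(p).\<close>

definition fourier_L1 :: "(real \<Rightarrow> complex) \<Rightarrow> real \<Rightarrow> complex" where
  "fourier_L1 f \<xi> = (LINT x|lborel. f x * cis (- (x * \<xi>)))"

text \<open>\<open>g\<close> represents the Fourier transform of \<open>f \<in> L\<^sup>2\<close>, i.e. the continuous extension
  to \<open>L\<^sup>2\<close> of the transform on the dense subspace \<open>L\<^sup>1 \<inter> L\<^sup>2\<close>.\<close>

definition fourier_L2 :: "(real \<Rightarrow> complex) \<Rightarrow> (real \<Rightarrow> complex) \<Rightarrow> bool" where
  "fourier_L2 f g \<longleftrightarrow> f \<in> Lp_space 2 \<and> g \<in> Lp_space 2 \<and>
    (\<exists>\<phi>. (\<forall>n. \<phi> n \<in> Lp_space 1 \<inter> Lp_space 2) \<and>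
         Lp_tendsto 2 \<phi> f \<and> Lp_tendsto 2 (\<lambda>n. fourier_L1 (\<phi> n)) g)"

text \<open>For \<open>f, h \<in> L\<^sup>2\<close>: the transform of \<open>h\<close> is \<open>1\<^sub>I\<close> times that of \<open>f\<close>.\<close>

definition freq_restr_L2 :: "real set \<Rightarrow> (real \<Rightarrow> complex) \<Rightarrow> (real \<Rightarrow> complex) \<Rightarrow> bool" where
  "freq_restr_L2 I f h \<longleftrightarrow>
    (\<exists>g. fourier_L2 f g \<and> fourier_L2 h (\<lambda>\<xi>. indicator I \<xi> * g \<xi>))"

text \<open>\<open>h\<close> represents the value at \<open>f \<in> L\<^sup>p\<close> of the extension by density of this
  operator from \<open>L\<^sup>2 \<inter> L\<^sup>p\<close> to \<open>L\<^sup>p\<close>. For \<open>1 < p < \<infinity>\<close> and an interval \<open>I\<close> the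
  operator is bounded in the \<open>L\<^sup>p\<close> norm (M. Riesz), so \<open>h\<close> exists and is unique up to a null
  set.\<close>

definition freq_restr :: "real \<Rightarrow> real set \<Rightarrow> (real \<Rightarrow> complex) \<Rightarrow> (real \<Rightarrow> complex) \<Rightarrow> bool" where
  "freq_restr p I f h \<longleftrightarrow> f \<in> Lp_space p \<and> h \<in> Lp_space p \<and>
    (\<exists>\<phi> \<eta>. (\<forall>n. \<phi> n \<in> Lp_space 2 \<inter> Lp_space p \<and> \<eta> n \<in> Lp_space 2 \<inter> Lp_space p \<and>
                freq_restr_L2 I (\<phi> n) (\<eta> n)) \<and>
           Lp_tendsto p \<phi> f \<and> Lp_tendsto p \<eta> h)"

definition square_fun :: "real set set \<Rightarrow> (real set \<Rightarrow> real \<Rightarrow> complex) \<Rightarrow> real \<Rightarrow> ennreal" where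
  "square_fun \<I> h x = epowr (\<Sum>\<^sub>\<infinity>I\<in>\<I>. (ennreal (norm (h I x)))\<^sup>2) (1 / 2)"

text \<open>Property LP(p), for closed null sets \<open>E\<close> and \<open>1 < p < \<infinity>\<close>. The complementary
  intervals serve as their own indices, and \<open>h I\<close> is any representative of the class
  \<open>S\<^sub>k f\<close> with \<open>I\<^sub>k = I\<close>.\<close>

definition has_LP :: "real \<Rightarrow> real set \<Rightarrow> bool" where
  "has_LP p E \<longleftrightarrow>
    (\<exists>c1 c2 :: real. c1 > 0 \<and> c2 > 0 \<and>
      (\<forall>f \<in> Lp_space p. \<forall>h. (\<forall>I \<in> components (- E). freq_restr p I f (h I)) \<longrightarrow>
         ennreal c1 * Lp_norm p f \<le> Lp_enorm p (square_fun (components (- E)) h) \<and>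
         Lp_enorm p (square_fun (components (- E)) h) \<le> ennreal c2 * Lp_norm p f))"

definition porous :: "real set \<Rightarrow> bool" where
  "porous F \<longleftrightarrow>
    (\<exists>c>0. \<forall>I. is_interval I \<and> bounded I \<and> measure lborel I > 0 \<longrightarrow>
      (\<exists>J. is_interval J \<and> J \<subseteq> I \<and> measure lborel J \<ge> c * measure lborel I \<and> J \<inter> F = {}))"

definition nbhd :: "real set \<Rightarrow> real \<Rightarrow> real set" where
  "nbhd F \<delta> = (\<Union>x\<in>F. ball x \<delta>)"

end

theory Submission
  imports Defs "HOL-Library.Discrete_Functions"
begin

text \<open>The set consists of tiny copies of the sets \<open>C\<^sub>n\<close> of all \<open>\<Sum>\<^sub>j\<^sub><\<^sub>n \<epsilon>\<^sub>j 4\<^sup>j\<close> with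
  \<open>\<epsilon>\<^sub>j \<in> {0, 1}\<close>, placed so that all base-4 digits of all points are 0 or 1; this gives porosity. The
  copies may shrink as fast as one likes, and only finitely many points are visible at scale
  \<open>\<delta>\<close>, which gives the bound on the neighbourhoods.

  In the gap to the right of every point of the \<open>n\<close>-th copy put a translate of one and the same
  triangular bump, and let \<open>f\<close> be the function whose Fourier transform is the sum of these bumps. In
  suitable units, with a Fejer kernel \<open>K\<close>, the square function of \<open>f\<close> is \<open>2\<^bsup>n/2\<^esup> K\<close>, while
  \<open>\<bar>f\<bar>\<close> is \<open>K\<close> times the product of all \<open>\<bar>1 + e\<^bsup>i x 4^j\<^esup>\<bar>\<close> with \<open>j < n\<close>. The
  normalized square of that product is the Riesz product of the factors \<open>1 + cos (4\<^sup>j x)\<close>. Integrating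
  out one factor at a time, averaging over the four preimages of a point under \<open>x \<mapsto> 4 x\<close>,
  shows that the mean of its power \<open>p/2\<close> grows or decays exponentially in \<open>n\<close> according to
  \<open>p > 2\<close> or \<open>p < 2\<close>. So the two norms are not comparable.\<close>

section \<open>Base-4 numbers with digits 0 and 1\<close>

text \<open>Rereads the binary digits of \<open>m\<close> in base 4, so that the values for
  \<open>m < 2 ^ n\<close> list \<open>C\<^sub>n\<close> in increasing order.\<close>

fun spread :: "nat \<Rightarrow> nat" where
  "spread m = (if m = 0 then 0 else 4 * spread (m div 2) + m mod 2)"

declare spread.simps [simp del]

lemma spread_0 [simp]: "spread 0 = 0"
  by (simp add: spread.simps)

lemma spread_double: "spread (2 * m) = 4 * spread m"
  by (subst spread.simps) auto

lemma spread_double_Suc: "spread (Suc (2 * m)) = Suc (4 * spread m)"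
  by (subst spread.simps) auto

lemma spread_1 [simp]: "spread (Suc 0) = 1"
  using spread_double_Suc[of 0] by simp

text \<open>Concatenation of digit strings: \<open>m\<close> supplies the low \<open>d\<close>
  digits and \<open>q\<close> the remaining ones, without any carry.\<close>

lemma spread_append: "m < 2 ^ d \<Longrightarrow> spread (2 ^ d * q + m) = 4 ^ d * spread q + spread m"
proof (induction d arbitrary: m)
  case (Suc d)
  obtain r b where m: "m = 2 * r + b" "b < 2"
    by (metis mod_less_divisor mult_div_mod_eq zero_less_numeral)
  have r: "r < 2 ^ d" using Suc.prems m by simp
  have e: "2 ^ Suc d * q + m = 2 * (2 ^ d * q + r) + b" using m by (simp add: algebra_simps)
  consider "b = 0" | "b = 1" using m by linarith
  then show ?case
  proof cases
    case 1
    have "spread (2 * (2 ^ d * q + r)) = 4 * (4 ^ d * spread q + spread r)"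
      using Suc.IH[OF r] by (simp only: spread_double)
    then show ?thesis unfolding e using 1 m spread_double[of r] by simp
  next
    case 2
    have "spread (Suc (2 * (2 ^ d * q + r))) = Suc (4 * (4 ^ d * spread q + spread r))"
      using Suc.IH[OF r] by (simp only: spread_double_Suc)
    then show ?thesis unfolding e using 2 m spread_double_Suc[of r] by simp
  qed
qed auto

text \<open>The extreme value is 1 + 4 + ... + 4^(d-1) = (4^d - 1) / 3. The factor 3 is what later
  keeps fractional parts below 1/2.\<close>

lemma spread_bound: "m < 2 ^ d \<Longrightarrow> 3 * spread m < 4 ^ d"
proof (induction d arbitrary: m)
  case (Suc d)
  have "m div 2 < 2 ^ d" using Suc.prems by simp
  from Suc.IH[OF this] have "3 * spread (m div 2) < 4 ^ d" .
  moreover have "spread m \<le> 4 * spread (m div 2) + 1"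
    by (subst spread.simps) auto
  ultimately show ?case by simp
qed auto

text \<open>If \<open>m\<close> is even, only the last digit changes. If
  \<open>m = 2 * r + 1\<close>, the carry leads to \<open>4 * spread (Suc r)\<close>, and the strict
  inequality for \<open>r\<close> gains 4, more than the lost digit 1.\<close>

lemma spread_Suc_less: "spread m < spread (Suc m)"
proof (induction m rule: less_induct)
  case (less m)
  obtain r where "m = 2 * r \<or> m = Suc (2 * r)" by (metis oddE evenE Suc_eq_plus1)
  then show ?case
  proof
    assume "m = Suc (2 * r)"
    moreover have "spread r < spread (Suc r)" using less \<open>m = _\<close> by auto
    ultimately show ?thesis
      using spread_double[of "Suc r"] by (simp add: spread_double_Suc)
  qed (simp add: spread_double spread_double_Suc)
qed

lemma spread_less_power: "spread m + 1 \<le> 4 ^ n" if "m < 2 ^ n"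
  using spread_bound[OF that] by linarith

lemma spread_div_power:
  "\<exists>(z::int) f. real (spread N) / 4 ^ d = of_int z + f \<and> 0 \<le> f \<and> f < 1/2"
proof -
  have r: "N mod 2 ^ d < 2 ^ d" by simp
  have "spread N = 4 ^ d * spread (N div 2 ^ d) + spread (N mod 2 ^ d)"
    using spread_append[OF r, of "N div 2 ^ d"] by simp
  then have "real (spread N) / 4 ^ d = real (spread (N div 2 ^ d)) + real (spread (N mod 2 ^ d)) / 4 ^ d"
    by (simp add: field_simps)
  moreover have "real (spread (N mod 2 ^ d)) / 4 ^ d < 1/2"
  proof -
    have "real (3 * spread (N mod 2 ^ d)) < real (4 ^ d)"
      using spread_bound[OF r] by (simp only: of_nat_less_iff)
    then show ?thesis by (simp add: field_simps)
  qed
  ultimately show ?thesis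
    by (intro exI[of _ "int (spread (N div 2 ^ d))"] exI[of _ "real (spread (N mod 2 ^ d)) / 4 ^ d"]) simp
qed

text \<open>Multiplying by \<open>4 ^ i\<close> only moves the base-4 point. The digits behind it
  are still 0 or 1, so the fractional part stays below 1/2. This is the arithmetic source of
  porosity.\<close>

lemma frac_spread_half:
  fixes j :: int
  shows "\<not> (of_int j + 1/2 < 4 ^ i * (real (spread N) / 4 ^ T) \<and> 4 ^ i * (real (spread N) / 4 ^ T) < of_int j + 1)"
proof -
  have "\<exists>(z::int) f. 4 ^ i * (real (spread N) / 4 ^ T) = of_int z + f \<and> 0 \<le> f \<and> f < 1/2"
  proof (cases "i \<le> T")
    case True
    then have "4 ^ i * (real (spread N) / 4 ^ T) = real (spread N) / 4 ^ (T - i)"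
      by (simp add: power_diff)
    then show ?thesis using spread_div_power[of N "T - i"] by simp
  next
    case False
    then have "(4::real) ^ i = 4 ^ (i - T) * 4 ^ T" by (simp flip: power_add)
    then have "4 ^ i * (real (spread N) / 4 ^ T) = of_int (int (spread N * 4 ^ (i - T)))"
      by simp
    then show ?thesis by (intro exI[of _ "int (spread N * 4 ^ (i - T))"] exI[of _ 0]) simp
  qed
  then obtain z :: int and f where zf: "4 ^ i * (real (spread N) / 4 ^ T) = of_int z + f" "0 \<le> f" "f < 1/2"
    by blast
  show ?thesis
  proof
    assume A: "of_int j + 1/2 < 4 ^ i * (real (spread N) / 4 ^ T) \<and> 4 ^ i * (real (spread N) / 4 ^ T) < of_int j + 1"
    then have "real_of_int j < of_int z" "real_of_int z < of_int j + 1" unfolding zf(1) using zf(2,3) by linarith+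
    then have "real_of_int j < of_int z" "real_of_int z < of_int (j + 1)" by simp_all
    then have "j < z" "z < j + 1" by (simp_all only: of_int_less_iff)
    then show False by simp
  qed
qed

section \<open>Powers of Riesz products\<close>

text \<open>By \<open>riesz_Suc\<close> this is the product of all 1 + cos (4^j x) with j < n. The
  form as an exponential sum is the one in which it appears in the modulus of the test
  functions.\<close>

definition riesz :: "nat \<Rightarrow> real \<Rightarrow> real" where
  "riesz n x = (cmod (\<Sum>m<2^n. cis (real (spread m) * x)))\<^sup>2 / 2 ^ n"

lemma riesz_nonneg: "riesz n x \<ge> 0"
  by (simp add: riesz_def)

lemma riesz_0: "riesz 0 x = 1"
  by (simp add: riesz_def)

lemma sum_lessThan_double: "(\<Sum>m<2 * N. f m) = (\<Sum>m<N. f (2 * m) + f (Suc (2 * m)))"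
  for f :: "nat \<Rightarrow> 'a :: comm_monoid_add"
  by (induction N) (simp_all add: algebra_simps)

lemma cmod_one_plus_cis: "(cmod (1 + cis x))\<^sup>2 = 2 * (1 + cos x)"
proof -
  have "(cos x)\<^sup>2 + (sin x)\<^sup>2 = 1" by simp
  then show ?thesis by (simp add: cmod_power2 power2_sum)
qed

text \<open>Grouping the indices by their last binary digit pulls 1 + \<open>cis x\<close> out of
  the sum and leaves the shorter sum at \<open>4 * x\<close>. The factor 2 in the squared modulus is
  absorbed by the normalization.\<close>

lemma riesz_Suc: "riesz (Suc n) x = (1 + cos x) * riesz n (4 * x)"
proof -
  have "(\<Sum>m<2^Suc n. cis (real (spread m) * x))
      = (\<Sum>m<2^n. (1 + cis x) * cis (real (spread m) * (4 * x)))"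
    unfolding power_Suc sum_lessThan_double
  proof (rule sum.cong[OF refl])
    fix m
    have "x + real (spread m) * (4 * x) = real (spread (Suc (2 * m))) * x"
      unfolding spread_double_Suc by (simp add: algebra_simps)
    then show "cis (real (spread (2 * m)) * x) + cis (real (spread (Suc (2 * m))) * x)
        = (1 + cis x) * cis (real (spread m) * (4 * x))"
      unfolding spread_double by (simp add: ring_distribs cis_mult mult_ac)
  qed
  also have "\<dots> = (1 + cis x) * (\<Sum>m<2^n. cis (real (spread m) * (4 * x)))"
    by (simp add: sum_distrib_left)
  finally show ?thesis
    by (simp add: riesz_def norm_mult power_mult_distrib cmod_one_plus_cis del: distrib_left_numeral)
qed

lemma riesz_periodic: "riesz n (x + 2 * pi * real k) = riesz n x"
proof -
  have "cis (real m * (x + 2 * pi * real k)) = cis (real m * x)" for m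
  proof -
    have "real m * (x + 2 * pi * real k) = real m * x + 2 * pi * real (m * k)"
      by (simp add: algebra_simps)
    moreover have "cis (2 * pi * real (m * k)) = 1" by (rule cis_multiple_2pi) auto
    ultimately show ?thesis by (simp flip: cis_mult)
  qed
  then show ?thesis by (simp add: riesz_def)
qed

lemma riesz_minus: "riesz n (- x) = riesz n x"
proof -
  have "(\<Sum>m<2^n. cis (real (spread m) * - x)) = cnj (\<Sum>m<2^n. cis (real (spread m) * x))"
    by (simp add: cis_cnj)
  then show ?thesis unfolding riesz_def by (simp only: complex_mod_cnj)
qed

lemma riesz_measurable [measurable]: "riesz n \<in> borel_measurable borel"
  unfolding riesz_def by (intro borel_measurable_continuous_onI continuous_intros) auto

section \<open>Averages of powers of 1 + cos over four preimages\<close>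

definition psum :: "real \<Rightarrow> real \<Rightarrow> real" where
  "psum q x = (1 + x) powr q + (1 - x) powr q"

lemma psum_deriv:
  assumes "0 < x" "x < 1"
  shows "(psum q has_real_derivative q * ((1 + x) powr (q - 1) - (1 - x) powr (q - 1))) (at x)"
  unfolding psum_def using assms
  by (auto intro!: derivative_eq_intros simp: algebra_simps)

lemma psum_cont: "q > 0 \<Longrightarrow> continuous_on {0..1} (psum q)"
  unfolding psum_def by (intro continuous_intros continuous_on_powr') auto

text \<open>The derivative has the sign of \<open>q - 1\<close>. With \<open>q = p / 2\<close> this
  is the origin of the dichotomy between p > 2 and p < 2.\<close>

lemma psum_strict_mono:
  assumes "q > 1" "0 \<le> x" "x < y" "y \<le> 1"
  shows "psum q x < psum q y"
proof (rule DERIV_pos_imp_increasing_open[OF \<open>x < y\<close>])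
  fix z assume z: "x < z" "z < y"
  have "(1 - z) powr (q - 1) < (1 + z) powr (q - 1)"
    by (rule powr_less_mono2) (use z assms in auto)
  then have "q * ((1 + z) powr (q - 1) - (1 - z) powr (q - 1)) > 0" using assms by simp
  then show "\<exists>D. (psum q has_real_derivative D) (at z) \<and> D > 0"
    using psum_deriv[of z q] z assms by force
qed (use psum_cont[of q] assms in \<open>auto intro: continuous_on_subset\<close>)

lemma psum_strict_antimono:
  assumes "0 < q" "q < 1" "0 \<le> x" "x < y" "y \<le> 1"
  shows "psum q y < psum q x"
proof (rule DERIV_neg_imp_decreasing_open[OF \<open>x < y\<close>])
  fix z assume z: "x < z" "z < y"
  have "(1 + z) powr (q - 1) < (1 - z) powr (q - 1)"
    by (rule powr_less_mono2_neg) (use z assms in auto)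
  then have "q * ((1 + z) powr (q - 1) - (1 - z) powr (q - 1)) < 0" using assms
    by (simp add: mult_less_0_iff)
  then show "\<exists>D. (psum q has_real_derivative D) (at z) \<and> D < 0"
    using psum_deriv[of z q] z assms by force
qed (use psum_cont[of q] assms in \<open>auto intro: continuous_on_subset\<close>)

lemma psum_0 [simp]: "psum q 0 = 2"
  by (simp add: psum_def)

lemma psum_abs: "psum q \<bar>x\<bar> = psum q x"
  by (simp add: psum_def abs_if)

text \<open>Extreme case in a bound for the mean over four preimages: one of cos and sin has modulus
  at least 1/2, and the other contributes at worst \<open>psum q 0 = 2\<close>.\<close>

definition avg_factor :: "real \<Rightarrow> real" where
  "avg_factor q = (psum q (1/2) + 2) / 4"

lemma cos_or_sin_large: "\<bar>cos \<theta>\<bar> \<ge> 1/2 \<or> \<bar>sin \<theta>\<bar> \<ge> (1/2::real)"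
proof (rule ccontr)
  assume "\<not> ?thesis"
  then have "\<bar>cos \<theta>\<bar> < 1/2" "\<bar>sin \<theta>\<bar> < 1/2" by auto
  then have "\<bar>cos \<theta>\<bar>\<^sup>2 < (1/2)\<^sup>2" "\<bar>sin \<theta>\<bar>\<^sup>2 < (1/2)\<^sup>2"
    by (intro power_strict_mono; simp)+
  then have "(cos \<theta>)\<^sup>2 < 1/4" "(sin \<theta>)\<^sup>2 < 1/4" by (simp_all add: power_divide)
  then show False using sin_cos_squared_add[of \<theta>] by linarith
qed

lemma psum_average_ge:
  assumes "q > 1"
  shows "psum q (cos \<theta>) + psum q (sin \<theta>) \<ge> 4 * avg_factor q"
proof -
  have A: "psum q x \<ge> 2" if "\<bar>x\<bar> \<le> 1" for x
    using psum_strict_mono[of q 0 "\<bar>x\<bar>"] that assms psum_abs[of q x] by (cases "x = 0") auto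
  have B: "psum q x \<ge> psum q (1/2)" if "\<bar>x\<bar> \<ge> 1/2" "\<bar>x\<bar> \<le> 1" for x
    using psum_strict_mono[of q "1/2" "\<bar>x\<bar>"] that assms psum_abs[of q x] by (cases "\<bar>x\<bar> = 1/2") auto
  show ?thesis
    using cos_or_sin_large[of \<theta>] A[of "cos \<theta>"] A[of "sin \<theta>"] B[of "cos \<theta>"] B[of "sin \<theta>"]
    by (auto simp: avg_factor_def)
qed

lemma psum_average_le:
  assumes "0 < q" "q < 1"
  shows "psum q (cos \<theta>) + psum q (sin \<theta>) \<le> 4 * avg_factor q"
proof -
  have A: "psum q x \<le> 2" if "\<bar>x\<bar> \<le> 1" for x
    using psum_strict_antimono[of q 0 "\<bar>x\<bar>"] that assms psum_abs[of q x] by (cases "x = 0") auto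
  have B: "psum q x \<le> psum q (1/2)" if "\<bar>x\<bar> \<ge> 1/2" "\<bar>x\<bar> \<le> 1" for x
    using psum_strict_antimono[of q "1/2" "\<bar>x\<bar>"] that assms psum_abs[of q x] by (cases "\<bar>x\<bar> = 1/2") auto
  show ?thesis
    using cos_or_sin_large[of \<theta>] A[of "cos \<theta>"] A[of "sin \<theta>"] B[of "cos \<theta>"] B[of "sin \<theta>"]
    by (auto simp: avg_factor_def)
qed

lemma avg_factor_gt_1: "q > 1 \<Longrightarrow> avg_factor q > 1"
  using psum_strict_mono[of q 0 "1/2"] by (simp add: avg_factor_def)

lemma avg_factor_less_1: "0 < q \<Longrightarrow> q < 1 \<Longrightarrow> avg_factor q < 1"
  using psum_strict_antimono[of q 0 "1/2"] by (simp add: avg_factor_def)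

lemma avg_factor_pos: "avg_factor q > 0"
  by (simp add: avg_factor_def psum_def add_nonneg_pos)

section \<open>Recursion for integrals of powers of Riesz products\<close>

lemma indicator_period_split:
  "indicator {0..<2 * pi} x = (\<Sum>k<4. indicator {pi / 2 * real k..<pi / 2 * real (Suc k)} x :: ennreal)"
  by (auto simp: indicator_def numeral_eq_Suc)

text \<open>Transfer-operator identity for \<open>x \<mapsto> 4 x\<close> on the circle.\<close>

lemma nn_integral_period_transfer:
  assumes [measurable]: "F \<in> borel_measurable borel" "G \<in> borel_measurable borel"
    and per: "\<And>x k. F (x + 2 * pi * real k) = F x"
  shows "(\<integral>\<^sup>+x. F (4 * x) * G x * indicator {0..<2 * pi} x \<partial>lborel)
       = (\<integral>\<^sup>+y. F y * (\<Sum>k<4. G (y / 4 + pi / 2 * real k)) / 4 * indicator {0..<2 * pi} y \<partial>lborel)"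
proof -
  have "(\<integral>\<^sup>+x. F (4 * x) * G x * indicator {0..<2 * pi} x \<partial>lborel)
      = (\<Sum>k<4. \<integral>\<^sup>+x. F (4 * x) * G x * indicator {pi / 2 * real k..<pi / 2 * real (Suc k)} x \<partial>lborel)"
    by (subst nn_integral_sum [symmetric]) (auto simp: indicator_period_split sum_distrib_left)
  also have "\<dots> = (\<Sum>k<4. ennreal (1/4) * (\<integral>\<^sup>+y. F y * G (y / 4 + pi / 2 * real k) * indicator {0..<2 * pi} y \<partial>lborel))"
  proof (rule sum.cong[OF refl])
    fix k :: nat
    \<comment> \<open>The substitution stretches the k-th quarter to a full period; the shift of the
      argument of \<open>F\<close> becomes 2 pi k and disappears by periodicity.\<close>
    have "F (4 * (pi / 2 * real k + 1 / 4 * y)) = F y" for y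
      using per[of y k] by (simp add: algebra_simps)
    moreover have "indicator {pi / 2 * real k..<pi / 2 * real (Suc k)} (pi / 2 * real k + 1 / 4 * y)
        = (indicator {0..<2 * pi} y :: ennreal)" for y
      by (auto simp: indicator_def algebra_simps)
    ultimately show "(\<integral>\<^sup>+x. F (4 * x) * G x * indicator {pi / 2 * real k..<pi / 2 * real (Suc k)} x \<partial>lborel)
       = ennreal (1/4) * (\<integral>\<^sup>+y. F y * G (y / 4 + pi / 2 * real k) * indicator {0..<2 * pi} y \<partial>lborel)"
      by (subst nn_integral_real_affine[where c = "1/4" and t = "pi / 2 * real k"]) (auto simp: add.commute)
  qed
  also have "\<dots> = (\<integral>\<^sup>+y. (\<Sum>k<4. ennreal (1/4) * (F y * G (y / 4 + pi / 2 * real k) * indicator {0..<2 * pi} y)) \<partial>lborel)"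
    by (subst nn_integral_sum) (auto simp: nn_integral_cmult)
  also have "\<dots> = (\<integral>\<^sup>+y. F y * (\<Sum>k<4. G (y / 4 + pi / 2 * real k)) / 4 * indicator {0..<2 * pi} y \<partial>lborel)"
  proof (rule nn_integral_cong)
    fix y
    have q: "ennreal (1/4) = 1 / 4" by (simp add: divide_ennreal_def inverse_ennreal flip: ennreal_numeral)
    show "(\<Sum>k<4. ennreal (1/4) * (F y * G (y / 4 + pi / 2 * real k) * indicator {0..<2 * pi} y))
       = F y * (\<Sum>k<4. G (y / 4 + pi / 2 * real k)) / 4 * indicator {0..<2 * pi} y"
      unfolding q sum_distrib_left[symmetric] sum_distrib_right[symmetric]
      by (simp add: divide_ennreal_def mult_ac)
  qed
  finally show ?thesis .
qed

text \<open>The four cosines are cos, -sin, -cos and sin of \<open>y/4\<close>; opposite values pair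
  up to \<open>psum\<close>.\<close>

lemma power_average_eq:
  "(\<Sum>k<4. ennreal ((1 + cos (y / 4 + pi / 2 * real k)) powr q)) = ennreal (psum q (cos (y/4)) + psum q (sin (y/4)))"
proof -
  have "cos (y / 4 + pi / 2 * 3) = sin (y/4)"
    using cos_add[of "y/4 + pi/2" pi] by (simp add: cos_add algebra_simps)
  then have c: "cos (y / 4 + pi * 3 / 2) = sin (y/4)" by (simp add: mult.commute)
  have "(\<Sum>k<4. ennreal ((1 + cos (y / 4 + pi / 2 * real k)) powr q))
      = ennreal (\<Sum>k<4. (1 + cos (y / 4 + pi / 2 * real k)) powr q)"
    by (rule sum_ennreal) simp
  also have "(\<Sum>k<4. (1 + cos (y / 4 + pi / 2 * real k)) powr q) = psum q (cos (y/4)) + psum q (sin (y/4))"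
    by (simp add: numeral_eq_Suc psum_def) (simp add: c, simp add: cos_add)
  finally show ?thesis .
qed

definition riesz_int :: "real \<Rightarrow> nat \<Rightarrow> ennreal" where
  "riesz_int q n = (\<integral>\<^sup>+x. ennreal (riesz n x powr q) * indicator {0..<2 * pi} x \<partial>lborel)"

lemma riesz_int_0: "riesz_int q 0 = ennreal (2 * pi)"
  by (simp add: riesz_int_def riesz_0)

text \<open>The factor 1 + cos x is integrated out: in \<open>riesz_Suc\<close> the remaining
  product depends on \<open>4 * x\<close> only, so the transfer identity averages the power of that
  single factor.\<close>

lemma riesz_int_Suc:
  "riesz_int q (Suc n) = (\<integral>\<^sup>+y. ennreal (riesz n y powr q) * ennreal ((psum q (cos (y/4)) + psum q (sin (y/4))) / 4)
     * indicator {0..<2 * pi} y \<partial>lborel)"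
proof -
  have "riesz_int q (Suc n) = (\<integral>\<^sup>+x. ennreal (riesz n (4 * x) powr q) * ennreal ((1 + cos x) powr q)
      * indicator {0..<2 * pi} x \<partial>lborel)"
    unfolding riesz_int_def
    by (intro nn_integral_cong) (simp add: riesz_Suc powr_mult riesz_nonneg ennreal_mult mult_ac)
  also have "\<dots> = (\<integral>\<^sup>+y. ennreal (riesz n y powr q) * (\<Sum>k<4. ennreal ((1 + cos (y / 4 + pi / 2 * real k)) powr q)) / 4
      * indicator {0..<2 * pi} y \<partial>lborel)"
    by (rule nn_integral_period_transfer[of "\<lambda>x. ennreal (riesz n x powr q)"])
      (simp_all add: riesz_periodic)
  also have "\<dots> = (\<integral>\<^sup>+y. ennreal (riesz n y powr q) * ennreal ((psum q (cos (y/4)) + psum q (sin (y/4))) / 4)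
     * indicator {0..<2 * pi} y \<partial>lborel)"
  proof (rule nn_integral_cong)
    fix y
    have "psum q (cos (y/4)) + psum q (sin (y/4)) \<ge> 0"
      by (simp add: psum_def add_nonneg_nonneg)
    then have "ennreal (psum q (cos (y/4)) + psum q (sin (y/4))) / 4 = ennreal ((psum q (cos (y/4)) + psum q (sin (y/4))) / 4)"
      by (metis divide_ennreal ennreal_numeral zero_less_numeral zero_le_numeral)
    then show "ennreal (riesz n y powr q) * (\<Sum>k<4. ennreal ((1 + cos (y / 4 + pi / 2 * real k)) powr q)) / 4
      * indicator {0..<2 * pi} y = ennreal (riesz n y powr q) * ennreal ((psum q (cos (y/4)) + psum q (sin (y/4))) / 4)
     * indicator {0..<2 * pi} y"
      unfolding power_average_eq by (simp add: ennreal_times_divide [symmetric])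
  qed
  finally show ?thesis .
qed

text \<open>Each step of the recursion gains at least the factor \<open>avg_factor q\<close>,
  because the averaged power is bounded below pointwise.\<close>

lemma riesz_int_ge:
  assumes "q > 1"
  shows "riesz_int q n \<ge> ennreal (2 * pi * avg_factor q ^ n)"
proof (induction n)
  case (Suc n)
  have "ennreal (2 * pi * avg_factor q ^ Suc n) = ennreal (2 * pi * avg_factor q ^ n) * ennreal (avg_factor q)"
    using avg_factor_pos[of q] by (subst ennreal_mult[symmetric]) (auto simp: mult_ac)
  also have "\<dots> \<le> riesz_int q n * ennreal (avg_factor q)"
    by (rule mult_right_mono[OF Suc]) simp
  also have "\<dots> = (\<integral>\<^sup>+x. ennreal (riesz n x powr q) * ennreal (avg_factor q) * indicator {0..<2 * pi} x \<partial>lborel)"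
    unfolding riesz_int_def by (subst nn_integral_multc [symmetric]) (auto simp: mult_ac)
  also have "\<dots> \<le> riesz_int q (Suc n)"
    unfolding riesz_int_Suc using psum_average_ge[OF assms]
    by (intro nn_integral_mono mult_right_mono mult_left_mono ennreal_leI) (auto simp: field_simps)
  finally show ?case .
qed (simp add: riesz_int_0)

lemma riesz_int_le:
  assumes "0 < q" "q < 1"
  shows "riesz_int q n \<le> ennreal (2 * pi * avg_factor q ^ n)"
proof (induction n)
  case (Suc n)
  have "riesz_int q (Suc n) \<le> (\<integral>\<^sup>+x. ennreal (riesz n x powr q) * ennreal (avg_factor q) * indicator {0..<2 * pi} x \<partial>lborel)"
    unfolding riesz_int_Suc using psum_average_le[OF assms]
    by (intro nn_integral_mono mult_right_mono mult_left_mono ennreal_leI) (auto simp: field_simps)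
  also have "\<dots> = riesz_int q n * ennreal (avg_factor q)"
    unfolding riesz_int_def by (subst nn_integral_multc [symmetric]) (auto simp: mult_ac)
  also have "\<dots> \<le> ennreal (2 * pi * avg_factor q ^ n) * ennreal (avg_factor q)"
    by (rule mult_right_mono[OF Suc]) simp
  also have "\<dots> = ennreal (2 * pi * avg_factor q ^ Suc n)"
    using avg_factor_pos[of q] by (subst ennreal_mult[symmetric]) (auto simp: mult_ac)
  finally show ?case .
qed (simp add: riesz_int_0)

section \<open>The Fejer kernel as a weight\<close>

text \<open>The Fejer kernel up to normalization, 2 sin(x/2)^2 / x^2. Division by zero gives it the
  value 0 at the origin, which integrals do not see.\<close>

definition fejer :: "real \<Rightarrow> real" where
  "fejer x = (1 - cos x) / x\<^sup>2"

lemma fejer_nonneg: "fejer x \<ge> 0"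
  by (simp add: fejer_def)

lemma fejer_minus: "fejer (- x) = fejer x"
  by (simp add: fejer_def)

lemma fejer_measurable [measurable]: "fejer \<in> borel_measurable borel"
  unfolding fejer_def by measurable

lemma fejer_le_1: "fejer x \<le> 1"
proof (cases "x = 0")
  case False
  have "1 - cos x = 2 * (sin (x/2))\<^sup>2"
    using cos_double_sin[of "x/2"] by simp
  also have "(sin (x/2))\<^sup>2 \<le> (x/2)\<^sup>2"
    using abs_sin_x_le_abs_x[of "x/2"] by (metis abs_le_square_iff)
  finally have "1 - cos x \<le> x\<^sup>2 / 2" by (simp add: power_divide)
  moreover have "x\<^sup>2 > 0" using False by simp
  ultimately have "1 - cos x \<le> x\<^sup>2" by linarith
  then show ?thesis using False by (simp add: fejer_def divide_le_eq)
qed (simp add: fejer_def)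

lemma fejer_decay: "fejer x \<le> 2 / x\<^sup>2"
  unfolding fejer_def by (rule divide_right_mono) (use cos_ge_minus_one[of x] in auto)

text \<open>Summable majorant of \<open>fejer (x / 4)\<close> on period \<open>k\<close>: the decay
  2 / (x/4)^2 is combined with x >= 2 (k + 1) for k >= 1, while for \<open>k = 0\<close> the value 8
  exceeds the bound 1.\<close>

definition period_weight :: "nat \<Rightarrow> real" where
  "period_weight k = 8 / (real k + 1)\<^sup>2"

lemma fejer_period_bound:
  assumes "x \<in> {2 * pi * real k..<2 * pi * real (Suc k)}"
  shows "fejer (x / 4) \<le> min 1 (period_weight k)"
proof (cases "k = 0")
  case True
  then show ?thesis using fejer_le_1 by (simp add: period_weight_def)
next
  case False
  then have k: "real k \<ge> 1" by simp
  have "3 * real k \<le> pi * real k" using pi_gt3 by (intro mult_right_mono) auto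
  then have "real k + 1 \<le> x / 2" using assms k unfolding atLeastLessThan_iff by linarith
  then have "(real k + 1)\<^sup>2 \<le> (x/2)\<^sup>2" using k by (intro power_mono) auto
  then have le: "(real k + 1)\<^sup>2 / 4 \<le> (x/4)\<^sup>2" by (simp add: power_divide)
  have pos: "(real k + 1)\<^sup>2 / 4 > 0" by simp
  have "2 / (x/4)\<^sup>2 \<le> 2 / ((real k + 1)\<^sup>2 / 4)"
    using le by (intro divide_left_mono mult_pos_pos) (auto intro: less_le_trans[OF pos])
  also have "\<dots> = 8 / (real k + 1)\<^sup>2" by simp
  finally have "fejer (x/4) \<le> 8 / (real k + 1)\<^sup>2" using fejer_decay[of "x/4"] by simp
  then show ?thesis using fejer_le_1 by (simp add: period_weight_def)
qed

lemma suminf_period_weight: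
  "summable period_weight" "(\<Sum>k. ennreal (period_weight k)) = ennreal (\<Sum>k. period_weight k)"
proof -
  have "summable (\<lambda>k. inverse (real (Suc k) ^ 2))"
    using inverse_power_summable[of 2] by (subst summable_Suc_iff) simp
  from summable_mult[OF this, of 8] show *: "summable period_weight"
    by (rule summable_cong[THEN iffD1, rotated]) (auto simp: period_weight_def field_simps)
  show "(\<Sum>k. ennreal (period_weight k)) = ennreal (\<Sum>k. period_weight k)"
    by (rule suminf_ennreal2[OF _ *]) (simp add: period_weight_def)
qed

lemma nn_integral_period_shift:
  assumes [measurable]: "F \<in> borel_measurable borel"
    and per: "\<And>x k. F (x + 2 * pi * real k) = F x"
  shows "(\<integral>\<^sup>+x. F x * indicator {2 * pi * real k..<2 * pi * real (Suc k)} x \<partial>lborel)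
    = (\<integral>\<^sup>+x. F x * indicator {0..<2 * pi} x \<partial>lborel)"
proof -
  have "indicator {2 * pi * real k..<2 * pi * real (Suc k)} (2 * pi * real k + x) = (indicator {0..<2 * pi} x :: ennreal)" for x
    by (auto simp: indicator_def algebra_simps)
  moreover have "F (2 * pi * real k + x) = F x" for x
    using per[of x k] by (simp add: add.commute)
  ultimately show ?thesis
    by (subst nn_integral_real_affine[where c = 1 and t = "2 * pi * real k"]) auto
qed

text \<open>On the half-line each period carries the same integral of \<open>F\<close> and a weight
  at most \<open>period_weight k\<close>; here p >= 1 and \<open>fejer\<close> <= 1 bound the power
  by the kernel itself. Evenness doubles the result.\<close>

lemma nn_integral_fejer_le:
  fixes F :: "real \<Rightarrow> ennreal"
  assumes [measurable]: "F \<in> borel_measurable borel"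
    and per: "\<And>x k. F (x + 2 * pi * real k) = F x"
    and even: "\<And>x. F (- x) = F x" and "p \<ge> 1"
  shows "(\<integral>\<^sup>+x. ennreal (fejer (x / 4) powr p) * F x \<partial>lborel)
    \<le> 2 * ennreal (\<Sum>k. period_weight k) * (\<integral>\<^sup>+x. F x * indicator {0..<2 * pi} x \<partial>lborel)"
proof -
  define G where "G = (\<lambda>x. ennreal (fejer (x / 4) powr p) * F x)"
  have [measurable]: "G \<in> borel_measurable borel" unfolding G_def by measurable
  define A where "A = (\<lambda>k. {2 * pi * real k..<2 * pi * real (Suc k)})"
  have [measurable]: "A k \<in> sets borel" for k unfolding A_def by simp
  have disj: "disjoint_family A"
  proof -
    have "k = l" if "x \<in> A k" "x \<in> A l" for k l x
    proof -
      have "2 * pi * real k < 2 * pi * real (Suc l)" "2 * pi * real l < 2 * pi * real (Suc k)"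
        using that unfolding A_def atLeastLessThan_iff by linarith+
      then show ?thesis by simp
    qed
    then show ?thesis by (auto simp: disjoint_family_on_def)
  qed
  have cover: "\<exists>k. x \<in> A k" if "x \<ge> 0" for x
  proof -
    define k where "k = nat \<lfloor>x / (2 * pi)\<rfloor>"
    have "real k \<le> x / (2 * pi)" "x / (2 * pi) < real k + 1"
      using that by (auto simp: k_def)
    then have "x \<in> A k" by (auto simp: A_def field_simps)
    then show ?thesis ..
  qed
  have le: "G x * indicator (A k) x \<le> ennreal (period_weight k) * (F x * indicator (A k) x)" for x k
  proof (cases "x \<in> A k")
    case True
    have b: "fejer (x/4) \<le> 1" "fejer (x/4) \<le> period_weight k"
      using fejer_period_bound[of x k] True by (auto simp: A_def)
    have "fejer (x/4) powr p \<le> fejer (x/4) powr 1"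
      using \<open>p \<ge> 1\<close> b fejer_nonneg by (intro powr_mono') auto
    also have "\<dots> \<le> period_weight k" using b fejer_nonneg by simp
    finally show ?thesis using True unfolding G_def
      by (auto intro!: mult_right_mono ennreal_leI)
  qed simp
  have half: "(\<integral>\<^sup>+x. G x * indicator {0..} x \<partial>lborel)
      \<le> ennreal (\<Sum>k. period_weight k) * (\<integral>\<^sup>+x. F x * indicator {0..<2 * pi} x \<partial>lborel)"
  proof -
    have "(\<integral>\<^sup>+x. G x * indicator {0..} x \<partial>lborel) \<le> (\<integral>\<^sup>+x. (\<Sum>k. G x * indicator (A k) x) \<partial>lborel)"
    proof (rule nn_integral_mono)
      fix x
      have "indicator {0..} x \<le> (indicator (\<Union>k. A k) x :: ennreal)"
        using cover[of x] by (auto simp: indicator_def)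
      also have "\<dots> = (\<Sum>k. indicator (A k) x)" by (rule suminf_indicator[OF disj, symmetric])
      finally show "G x * indicator {0..} x \<le> (\<Sum>k. G x * indicator (A k) x)"
        by (simp add: mult_left_mono)
    qed
    also have "\<dots> = (\<Sum>k. \<integral>\<^sup>+x. G x * indicator (A k) x \<partial>lborel)"
      by (rule nn_integral_suminf) auto
    also have "\<dots> \<le> (\<Sum>k. \<integral>\<^sup>+x. ennreal (period_weight k) * (F x * indicator (A k) x) \<partial>lborel)"
      by (intro suminf_le nn_integral_mono le) auto
    also have "\<dots> = (\<Sum>k. ennreal (period_weight k) * (\<integral>\<^sup>+x. F x * indicator {0..<2 * pi} x \<partial>lborel))"
    proof (rule suminf_cong)
      fix k
      have "(\<integral>\<^sup>+x. ennreal (period_weight k) * (F x * indicator (A k) x) \<partial>lborel)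
          = ennreal (period_weight k) * (\<integral>\<^sup>+x. F x * indicator (A k) x \<partial>lborel)"
        by (rule nn_integral_cmult) auto
      then show "(\<integral>\<^sup>+x. ennreal (period_weight k) * (F x * indicator (A k) x) \<partial>lborel)
          = ennreal (period_weight k) * (\<integral>\<^sup>+x. F x * indicator {0..<2 * pi} x \<partial>lborel)"
        unfolding A_def nn_integral_period_shift[of F, OF assms(1) per] by simp
    qed
    also have "\<dots> = ennreal (\<Sum>k. period_weight k) * (\<integral>\<^sup>+x. F x * indicator {0..<2 * pi} x \<partial>lborel)"
      by (simp only: suminf_period_weight(2) ennreal_suminf_multc)
    finally show ?thesis .
  qed
  have "(\<integral>\<^sup>+x. G x \<partial>lborel) \<le> (\<integral>\<^sup>+x. G x * indicator {0..} x + G x * indicator {..0} x \<partial>lborel)"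
    by (intro nn_integral_mono) (auto simp: indicator_def)
  also have "\<dots> = (\<integral>\<^sup>+x. G x * indicator {0..} x \<partial>lborel) + (\<integral>\<^sup>+x. G x * indicator {..0} x \<partial>lborel)"
    by (rule nn_integral_add) auto
  also have "(\<integral>\<^sup>+x. G x * indicator {..0} x \<partial>lborel) = (\<integral>\<^sup>+x. G x * indicator {0..} x \<partial>lborel)"
  proof -
    have "G (- x) = G x" for x using fejer_minus[of "x/4"] by (simp add: G_def even)
    moreover have "indicator {..0} (- x) = (indicator {0..} x :: ennreal)" for x :: real
      by (auto simp: indicator_def)
    ultimately show ?thesis
      by (subst nn_integral_real_affine[where c = "-1" and t = 0]) auto
  qed
  also have "(\<integral>\<^sup>+x. G x * indicator {0..} x \<partial>lborel) + (\<integral>\<^sup>+x. G x * indicator {0..} x \<partial>lborel)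
      \<le> 2 * (ennreal (\<Sum>k. period_weight k) * (\<integral>\<^sup>+x. F x * indicator {0..<2 * pi} x \<partial>lborel))"
    by (subst mult_2) (rule add_mono[OF half half])
  finally show ?thesis by (simp add: G_def mult.assoc)
qed

text \<open>One period suffices: for x in [2 pi, 4 pi) the point x/4 lies in [pi/2, pi), where the
  numerator of the kernel is at least 1 and the denominator at most pi^2.\<close>

lemma nn_integral_fejer_ge:
  fixes F :: "real \<Rightarrow> ennreal"
  assumes [measurable]: "F \<in> borel_measurable borel"
    and per: "\<And>x k. F (x + 2 * pi * real k) = F x" and "p \<ge> 0"
  shows "ennreal ((1 / pi\<^sup>2) powr p) * (\<integral>\<^sup>+x. F x * indicator {0..<2 * pi} x \<partial>lborel)
    \<le> (\<integral>\<^sup>+x. ennreal (fejer (x / 4) powr p) * F x \<partial>lborel)"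
proof -
  have b: "1 / pi\<^sup>2 \<le> fejer (x / 4)" if "x \<in> {2 * pi * real 1..<2 * pi * real (Suc 1)}" for x
  proof -
    have "x / 4 \<ge> pi / 2" "x / 4 \<le> pi" using that by auto
    then have "cos (x / 4) \<le> cos (pi / 2)" by (intro cos_monotone_0_pi_le) auto
    moreover have "(x/4)\<^sup>2 \<le> pi\<^sup>2" "(x/4)\<^sup>2 > 0" using that \<open>x / 4 \<le> pi\<close> pi_gt_zero
      by (auto intro!: power_mono simp del: pi_gt_zero)
    ultimately show ?thesis unfolding fejer_def by (intro frac_le) auto
  qed
  have "ennreal ((1 / pi\<^sup>2) powr p) * (\<integral>\<^sup>+x. F x * indicator {0..<2 * pi} x \<partial>lborel)
      = ennreal ((1 / pi\<^sup>2) powr p) * (\<integral>\<^sup>+x. F x * indicator {2 * pi * real 1..<2 * pi * real (Suc 1)} x \<partial>lborel)"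
    by (simp only: nn_integral_period_shift[OF assms(1,2)])
  also have "\<dots> = (\<integral>\<^sup>+x. ennreal ((1 / pi\<^sup>2) powr p) * (F x * indicator {2 * pi * real 1..<2 * pi * real (Suc 1)} x) \<partial>lborel)"
    by (rule nn_integral_cmult [symmetric]) auto
  also have "\<dots> \<le> (\<integral>\<^sup>+x. ennreal (fejer (x / 4) powr p) * F x \<partial>lborel)"
  proof (rule nn_integral_mono)
    fix x :: real
    show "ennreal ((1 / pi\<^sup>2) powr p) * (F x * indicator {2 * pi * real 1..<2 * pi * real (Suc 1)} x)
        \<le> ennreal (fejer (x / 4) powr p) * F x"
    proof (cases "x \<in> {2 * pi * real 1..<2 * pi * real (Suc 1)}")
      case True
      then have "(1 / pi\<^sup>2) powr p \<le> fejer (x / 4) powr p"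
        using \<open>p \<ge> 0\<close> b by (intro powr_mono2) auto
      then show ?thesis using True by (auto intro!: mult_right_mono ennreal_leI)
    qed simp
  qed
  finally show ?thesis .
qed

text \<open>Up to a factor common to all of them, the p-th power of the norm of the n-th test
  function. For \<open>n = 0\<close> the Riesz product is 1, and the integral belongs to the square
  function.\<close>

definition weighted_int :: "real \<Rightarrow> nat \<Rightarrow> ennreal" where
  "weighted_int p n = (\<integral>\<^sup>+x. ennreal (fejer (x / 4) powr p * riesz n x powr (p / 2)) \<partial>lborel)"

lemma weighted_int_bounds:
  assumes "p \<ge> 1"
  shows "ennreal ((1 / pi\<^sup>2) powr p) * riesz_int (p / 2) n \<le> weighted_int p n"
    "weighted_int p n \<le> 2 * ennreal (\<Sum>k. period_weight k) * riesz_int (p / 2) n"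
proof -
  have "weighted_int p n = (\<integral>\<^sup>+x. ennreal (fejer (x / 4) powr p) * ennreal (riesz n x powr (p / 2)) \<partial>lborel)"
    by (simp add: weighted_int_def ennreal_mult)
  moreover have [measurable]: "(\<lambda>x. ennreal (riesz n x powr (p / 2))) \<in> borel_measurable borel" by measurable
  ultimately show "ennreal ((1 / pi\<^sup>2) powr p) * riesz_int (p / 2) n \<le> weighted_int p n"
    "weighted_int p n \<le> 2 * ennreal (\<Sum>k. period_weight k) * riesz_int (p / 2) n"
    unfolding riesz_int_def using assms
      nn_integral_fejer_ge[of "\<lambda>x. ennreal (riesz n x powr (p / 2))" p]
      nn_integral_fejer_le[of "\<lambda>x. ennreal (riesz n x powr (p / 2))" p]
    by (auto simp: riesz_periodic riesz_minus)
qed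

lemma weighted_int_0_pos: "p \<ge> 1 \<Longrightarrow> weighted_int p 0 > 0"
  by (rule order.strict_trans2[OF _ weighted_int_bounds(1)])
    (simp_all add: riesz_int_0 flip: ennreal_mult)

lemma weighted_int_0_finite: "p \<ge> 1 \<Longrightarrow> weighted_int p 0 < \<infinity>"
  by (rule order.strict_trans1[OF weighted_int_bounds(2)])
    (simp_all add: riesz_int_0 ennreal_mult_less_top)

lemma weighted_int_unbounded:
  assumes "p > 2" "C < \<infinity>"
  shows "\<exists>n. weighted_int p n > C"
proof -
  obtain c where c: "C = ennreal c" "c \<ge> 0" using assms by (cases C) auto
  define b where "b = (1 / pi\<^sup>2) powr p * (2 * pi)"
  have "b > 0" by (simp add: b_def)
  obtain n where n: "c / b < avg_factor (p/2) ^ n"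
    using real_arch_pow[OF avg_factor_gt_1[of "p/2"]] assms by auto
  have "C < ennreal (b * avg_factor (p/2) ^ n)"
    using n \<open>b > 0\<close> c by (simp add: field_simps ennreal_less_iff)
  also have "\<dots> = ennreal ((1 / pi\<^sup>2) powr p) * ennreal (2 * pi * avg_factor (p/2) ^ n)"
    by (subst ennreal_mult'[symmetric]) (simp_all add: b_def mult.assoc)
  also have "\<dots> \<le> ennreal ((1 / pi\<^sup>2) powr p) * riesz_int (p/2) n"
    using riesz_int_ge[of "p/2" n] assms by (intro mult_left_mono) auto
  also have "\<dots> \<le> weighted_int p n" using weighted_int_bounds(1)[of p n] assms by simp
  finally show ?thesis ..
qed

lemma weighted_int_small:
  assumes "1 < p" "p < 2" "C > 0"
  shows "\<exists>n. weighted_int p n < C"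
proof -
  obtain c where c: "ennreal c < C" "c > 0"
    using assms(3) by (metis ennreal_less_zero_iff dense ennreal_cases top_greatest order_less_imp_not_less infinity_ennreal_def not_less_iff_gr_or_eq top.not_eq_extremum)
  define b where "b = 2 * (\<Sum>k. period_weight k) * (2 * pi)"
  have S: "(\<Sum>k. period_weight k) > 0"
    by (rule suminf_pos[OF suminf_period_weight(1)]) (simp add: period_weight_def)
  then have "b > 0" by (simp add: b_def)
  obtain n where n: "avg_factor (p/2) ^ n < c / b"
    using real_arch_pow_inv[of "c/b" "avg_factor (p/2)"] avg_factor_less_1[of "p/2"] assms c \<open>b > 0\<close> by auto
  have "weighted_int p n \<le> 2 * ennreal (\<Sum>k. period_weight k) * riesz_int (p/2) n"
    using weighted_int_bounds(2)[of p n] assms by simp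
  also have "\<dots> \<le> 2 * ennreal (\<Sum>k. period_weight k) * ennreal (2 * pi * avg_factor (p/2) ^ n)"
    using riesz_int_le[of "p/2" n] assms by (intro mult_left_mono) auto
  also have "\<dots> = ennreal (b * avg_factor (p/2) ^ n)"
  proof -
    have "2 * ennreal (\<Sum>k. period_weight k) = ennreal (2 * (\<Sum>k. period_weight k))"
      using S by (simp add: ennreal_mult)
    moreover have "ennreal (b * avg_factor (p/2) ^ n)
        = ennreal (2 * (\<Sum>k. period_weight k)) * ennreal (2 * pi * avg_factor (p/2) ^ n)"
      using S by (subst ennreal_mult'[symmetric]) (auto simp: b_def mult.assoc)
    ultimately show ?thesis by (simp only:)
  qed
  also have "\<dots> \<le> ennreal c" using n \<open>b > 0\<close> by (intro ennreal_leI) (simp add: field_simps)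
  also have "\<dots> < C" by fact
  finally show ?thesis ..
qed

section \<open>Real powers, Lebesgue spaces and frequency restriction\<close>

lemma epowr_ennreal: "a \<ge> 0 \<Longrightarrow> epowr (ennreal a) p = ennreal (a powr p)"
  by (simp add: epowr_def)

lemma epowr_less_top_iff: "epowr x p < \<infinity> \<longleftrightarrow> x < \<infinity>"
  by (auto simp: epowr_def less_top)

lemma Lp_norm_alt: "Lp_norm p f = epowr (\<integral>\<^sup>+x. ennreal (norm (f x) powr p) \<partial>lborel) (1 / p)"
  by (simp add: Lp_norm_def Lp_enorm_def epowr_ennreal)

lemma Lp_space_iff:
  "f \<in> Lp_space p \<longleftrightarrow> f \<in> borel_measurable borel \<and> (\<integral>\<^sup>+x. ennreal (norm (f x) powr p) \<partial>lborel) < \<infinity>"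
  by (simp add: Lp_space_def Lp_norm_alt epowr_less_top_iff del: infinity_ennreal_def)

lemma Lp_tendsto_const: "Lp_tendsto p (\<lambda>_. f) f"
  by (simp add: Lp_tendsto_def Lp_norm_alt epowr_ennreal[of 0, simplified])

lemma fourier_L2_of_L1:
  assumes "f \<in> Lp_space 1" "f \<in> Lp_space 2" "fourier_L1 f \<in> Lp_space 2"
  shows "fourier_L2 f (fourier_L1 f)"
  unfolding fourier_L2_def using assms Lp_tendsto_const
  by (auto intro!: exI[of _ "\<lambda>_. f"])

text \<open>All functions involved lie in every space that occurs, so constant sequences serve as
  the approximations in both extensions by density.\<close>

lemma freq_restr_of_L1:
  assumes "f \<in> Lp_space 1" "f \<in> Lp_space 2" "f \<in> Lp_space p" "fourier_L1 f \<in> Lp_space 2"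
    and "h \<in> Lp_space 1" "h \<in> Lp_space 2" "h \<in> Lp_space p" "fourier_L1 h \<in> Lp_space 2"
    and "\<And>\<xi>. fourier_L1 h \<xi> = indicator I \<xi> * fourier_L1 f \<xi>"
  shows "freq_restr p I f h"
proof -
  have "fourier_L1 h = (\<lambda>\<xi>. indicator I \<xi> * fourier_L1 f \<xi>)" using assms by auto
  then have "freq_restr_L2 I f h"
    unfolding freq_restr_L2_def using fourier_L2_of_L1[of f] fourier_L2_of_L1[of h] assms by metis
  then show ?thesis
    unfolding freq_restr_def using assms Lp_tendsto_const
    by (intro conjI exI[of _ "\<lambda>_. f"] exI[of _ "\<lambda>_. h"]) auto
qed

lemma epowr_le_iff:
  assumes "a > 0"
  shows "epowr x a \<le> epowr y a \<longleftrightarrow> x \<le> y"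
proof (cases x; cases y)
  fix r s :: real
  assume rs: "0 \<le> r" "x = ennreal r" "0 \<le> s" "y = ennreal s"
  have "r powr a \<le> s powr a \<longleftrightarrow> r \<le> s"
    using powr_mono2[of a r s] powr_less_mono2[of a s r] assms rs by (auto simp: not_le[symmetric])
  then show ?thesis using rs by (simp add: epowr_ennreal)
qed (auto simp: epowr_def top_unique)

lemma epowr_scale:
  assumes "c > 0" "p > 0"
  shows "epowr (ennreal (c powr p) * x) (1 / p) = ennreal c * epowr x (1 / p)"
proof (cases x)
  case (real r)
  then show ?thesis using assms
    by (simp add: epowr_ennreal powr_mult powr_powr flip: ennreal_mult)
qed (use assms in \<open>simp add: epowr_def ennreal_mult_top\<close>)

section \<open>Sums of modulated Fejer kernels\<close>

lemma integrable_fejer: "integrable lborel fejer"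
proof -
  have "weighted_int 1 0 < \<infinity>" by (rule weighted_int_0_finite) simp
  then have "integrable lborel (\<lambda>x. fejer (0 + (1/4) * x))"
    by (intro integrableI_bounded)
      (auto simp: weighted_int_def riesz_0 fejer_nonneg)
  then show ?thesis
    by (subst (asm) lborel_integrable_real_affine_iff) auto
qed

definition fejer_mass :: real where
  "fejer_mass = (LINT x|lborel. fejer x)"

text \<open>The integrand is \<open>a\<^sup>2 * fejer (a * x)\<close> when \<open>a\<close> is
  nonzero, and the substitution divides by the modulus of \<open>a\<close>.\<close>

lemma has_integral_fejer_scaled:
  "has_bochner_integral lborel (\<lambda>x. (1 - cos (a * x)) / x\<^sup>2) (\<bar>a\<bar> * fejer_mass)"
proof (cases "a = 0")
  case False
  have "has_bochner_integral lborel fejer fejer_mass"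
    using integrable_fejer by (simp add: has_bochner_integral_iff fejer_mass_def)
  with False have "has_bochner_integral lborel (\<lambda>x. fejer (0 + a * x)) (fejer_mass /\<^sub>R \<bar>a\<bar>)"
    by (subst (asm) lborel_has_bochner_integral_real_affine_iff[of a _ _ 0])
  then
  have "has_bochner_integral lborel (\<lambda>x. a\<^sup>2 * fejer (0 + a * x)) (a\<^sup>2 * (fejer_mass /\<^sub>R \<bar>a\<bar>))"
    by (rule has_bochner_integral_mult_right)
  moreover have "a\<^sup>2 * fejer (0 + a * x) = (1 - cos (a * x)) / x\<^sup>2" for x
    using False by (simp add: fejer_def power_mult_distrib)
  moreover have "a\<^sup>2 * (fejer_mass /\<^sub>R \<bar>a\<bar>) = \<bar>a\<bar> * fejer_mass"
  proof -
    have sq: "a\<^sup>2 = \<bar>a\<bar> * \<bar>a\<bar>" by (simp add: power2_eq_square)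
    show ?thesis unfolding sq using False by (simp add: mult.assoc del: abs_mult_self_eq)
  qed
  ultimately show ?thesis by (simp only:)
qed (simp add: has_bochner_integral_zero)

text \<open>The product \<open>(1 - cos x) cos (\<xi> x)\<close> is a combination of functions
  \<open>1 - cos (a x)\<close>, whose integrals against \<open>x\<^sup>-\<^sup>2\<close> are known up to a common factor by scaling.\<close>

lemma has_integral_fejer_cos:
  "has_bochner_integral lborel (\<lambda>x. fejer x * cos (\<xi> * x)) (fejer_mass * max 0 (1 - \<bar>\<xi>\<bar>))"
proof -
  have "has_bochner_integral lborel
      (\<lambda>x. 1/2 * ((1 - cos ((1 + \<xi>) * x)) / x\<^sup>2) + 1/2 * ((1 - cos ((1 - \<xi>) * x)) / x\<^sup>2) - (1 - cos (\<xi> * x)) / x\<^sup>2)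
      (1/2 * (\<bar>1 + \<xi>\<bar> * fejer_mass) + 1/2 * (\<bar>1 - \<xi>\<bar> * fejer_mass) - \<bar>\<xi>\<bar> * fejer_mass)"
    by (intro has_bochner_integral_add has_bochner_integral_diff has_bochner_integral_mult_right
        has_integral_fejer_scaled)
  moreover have "1/2 * ((1 - cos ((1 + \<xi>) * x)) / x\<^sup>2) + 1/2 * ((1 - cos ((1 - \<xi>) * x)) / x\<^sup>2) - (1 - cos (\<xi> * x)) / x\<^sup>2
      = fejer x * cos (\<xi> * x)" for x
  proof -
    have "cos ((1 + \<xi>) * x) + cos ((1 - \<xi>) * x) = 2 * cos x * cos (\<xi> * x)"
      by (simp add: algebra_simps cos_add cos_diff)
    then have "1/2 * (1 - cos ((1 + \<xi>) * x)) + 1/2 * (1 - cos ((1 - \<xi>) * x)) - (1 - cos (\<xi> * x))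
        = (1 - cos x) * cos (\<xi> * x)"
      by (simp add: ring_distribs)
    moreover have "1/2 * (a / d) + 1/2 * (b / d) - c / d = (1/2 * a + 1/2 * b - c) / d" for a b c d :: real
      by (simp add: add_divide_distrib diff_divide_distrib)
    ultimately show ?thesis by (simp only: fejer_def times_divide_eq_left)
  qed
  moreover have "1/2 * (\<bar>1 + \<xi>\<bar> * fejer_mass) + 1/2 * (\<bar>1 - \<xi>\<bar> * fejer_mass) - \<bar>\<xi>\<bar> * fejer_mass
      = fejer_mass * max 0 (1 - \<bar>\<xi>\<bar>)"
  proof -
    \<comment> \<open>Half the second difference of the modulus with step 1 is the triangle
      function.\<close>
    have "1/2 * \<bar>1 + \<xi>\<bar> + 1/2 * \<bar>1 - \<xi>\<bar> - \<bar>\<xi>\<bar> = max 0 (1 - \<bar>\<xi>\<bar>)" by (auto simp: abs_if max_def field_simps)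
    then show ?thesis by (metis (no_types, opaque_lifting) left_diff_distrib distrib_right mult.assoc mult.commute)
  qed
  ultimately show ?thesis by simp
qed

lemma cis_mult_measurable [measurable]: "(\<lambda>x. cis (c * x)) \<in> borel_measurable borel"
  by (intro borel_measurable_continuous_onI continuous_intros)

lemma integrable_fejer_cis: "integrable lborel (\<lambda>x. complex_of_real (fejer x) * cis (c * x))"
  by (rule Bochner_Integration.integrable_bound[OF integrable_fejer]) (auto simp: norm_mult)

text \<open>The kernel is even, so averaging the integrals for \<open>\<xi>\<close> and
  \<open>- \<xi>\<close> replaces \<open>cis\<close> by the cosine.\<close>

lemma integral_fejer_cis:
  "(LINT x|lborel. complex_of_real (fejer x) * cis (\<xi> * x)) = of_real (fejer_mass * max 0 (1 - \<bar>\<xi>\<bar>))"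
proof -
  let ?I = "\<lambda>\<xi>. LINT x|lborel. complex_of_real (fejer x) * cis (\<xi> * x)"
  have "?I \<xi> = ?I (- \<xi>)"
    by (subst lborel_integral_real_affine[where c = "-1" and t = 0]) (auto simp: fejer_minus)
  then have "2 * ?I \<xi> = ?I \<xi> + ?I (- \<xi>)" by simp
  also have "\<dots> = (LINT x|lborel. complex_of_real (2 * (fejer x * cos (\<xi> * x))))"
  proof -
    have "complex_of_real (fejer x) * cis (\<xi> * x) + complex_of_real (fejer x) * cis (- \<xi> * x)
        = complex_of_real (2 * (fejer x * cos (\<xi> * x)))" for x
      by (simp add: complex_eq_iff)
    then show ?thesis
      using Bochner_Integration.integral_add[OF integrable_fejer_cis[of \<xi>] integrable_fejer_cis[of "- \<xi>"]]
      by simp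
  qed
  also have "\<dots> = 2 * of_real (fejer_mass * max 0 (1 - \<bar>\<xi>\<bar>))"
    using has_integral_fejer_cos[of \<xi>] by (subst integral_complex_of_real) (simp add: has_bochner_integral_iff)
  finally show ?thesis by simp
qed

section \<open>Test functions whose transforms are sums of bumps\<close>

definition wave :: "real \<Rightarrow> real \<Rightarrow> real \<Rightarrow> complex" where
  "wave s \<alpha> x = cis (\<alpha> * x) * of_real (fejer (s * x / 4))"

lemma norm_wave: "norm (wave s \<alpha> x) = fejer (s * x / 4)"
  by (simp add: wave_def norm_mult fejer_nonneg)

lemma wave_measurable [measurable]: "wave s \<alpha> \<in> borel_measurable borel"
  unfolding wave_def by measurable

lemma nn_integral_scale:
  assumes "s > 0" and [measurable]: "F \<in> borel_measurable borel"
  shows "(\<integral>\<^sup>+x. F (s * x) \<partial>lborel) = ennreal (1 / s) * (\<integral>\<^sup>+x. F x \<partial>lborel)"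
  using assms nn_integral_real_affine[of "\<lambda>x. F (s * x)" "1 / s" 0] by simp

definition wave_sum :: "real \<Rightarrow> ('i \<Rightarrow> real) \<Rightarrow> 'i set \<Rightarrow> real \<Rightarrow> complex" where
  "wave_sum s \<alpha> K x = (\<Sum>k\<in>K. wave s (\<alpha> k) x)"

definition bump :: "real \<Rightarrow> real \<Rightarrow> real \<Rightarrow> complex" where
  "bump s \<alpha> \<xi> = of_real (4 / s * (fejer_mass * max 0 (1 - \<bar>4 * (\<xi> - \<alpha>) / s\<bar>)))"

text \<open>Modulation by \<open>\<alpha>\<close> and dilation by \<open>s / 4\<close> move the
  triangle to centre \<open>\<alpha>\<close> with half-width \<open>s / 4\<close>. A bump centred in
  a gap of length \<open>s\<close> thus fills only the middle half of the gap.\<close>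

lemma fourier_wave:
  assumes "s > 0"
  shows "integrable lborel (\<lambda>x. wave s \<alpha> x * cis (- (x * \<xi>)))" "fourier_L1 (wave s \<alpha>) \<xi> = bump s \<alpha> \<xi>"
proof -
  \<comment> \<open>The substitution that undoes the dilation; the summand \<open>0 +\<close>
    matches the shape of the affine change of variables.\<close>
  have e: "wave s \<alpha> (0 + 4 / s * x) * cis (- ((0 + 4 / s * x) * \<xi>))
      = complex_of_real (fejer x) * cis (- (4 * (\<xi> - \<alpha>) / s) * x)" for x
  proof -
    have "\<alpha> * (0 + 4 / s * x) + - ((0 + 4 / s * x) * \<xi>) = - (4 * (\<xi> - \<alpha>) / s) * x"
      using assms by (simp add: field_simps)
    moreover have "s * (0 + 4 / s * x) / 4 = x" using assms by simp
    moreover have "wave s \<alpha> y * cis (- (y * \<xi>)) = of_real (fejer (s * y / 4)) * cis (\<alpha> * y + - (y * \<xi>))" for y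
      unfolding wave_def cis_mult[symmetric] by (simp only: mult_ac)
    ultimately show ?thesis by (simp only:)
  qed
  show "integrable lborel (\<lambda>x. wave s \<alpha> x * cis (- (x * \<xi>)))"
    using integrable_fejer_cis assms
    by (subst lborel_integrable_real_affine_iff[symmetric, of "4 / s" _ 0]) (auto simp only: e, auto)
  show "fourier_L1 (wave s \<alpha>) \<xi> = bump s \<alpha> \<xi>"
    unfolding fourier_L1_def using assms
    by (subst lborel_integral_real_affine[where c = "4 / s" and t = 0])
      (auto simp only: e integral_fejer_cis, auto simp: bump_def scaleR_conv_of_real)
qed

lemma fourier_wave_sum:
  assumes "s > 0"
  shows "fourier_L1 (wave_sum s \<alpha> K) \<xi> = (\<Sum>k\<in>K. bump s (\<alpha> k) \<xi>)"
  unfolding wave_sum_def using assms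
  by (simp add: fourier_L1_def sum_distrib_right Bochner_Integration.integral_sum fourier_wave(1)
      flip: fourier_wave(2))

lemma bump_eq_0: "s > 0 \<Longrightarrow> \<bar>\<xi> - \<alpha>\<bar> \<ge> s / 4 \<Longrightarrow> bump s \<alpha> \<xi> = 0"
  using le_divide_eq[of 1 "4 * \<bar>\<xi> - \<alpha>\<bar>" s]
  by (simp add: bump_def abs_mult del: right_diff_distrib_numeral)

lemma norm_wave_sum_le: "finite K \<Longrightarrow> norm (wave_sum s \<alpha> K x) \<le> real (card K) * fejer (s * x / 4)"
  unfolding wave_sum_def by (rule order_trans[OF norm_sum]) (simp add: norm_wave)

lemma wave_sum_measurable [measurable]: "wave_sum s \<alpha> K \<in> borel_measurable borel"
  unfolding wave_sum_def by measurable

lemma wave_sum_Lp: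
  assumes "finite K" "s > 0" "p \<ge> 1"
  shows "wave_sum s \<alpha> K \<in> Lp_space p"
proof -
  have "(\<integral>\<^sup>+x. ennreal (norm (wave_sum s \<alpha> K x) powr p) \<partial>lborel)
      \<le> (\<integral>\<^sup>+x. ennreal (real (card K) powr p) * ennreal (fejer (s * x / 4) powr p) \<partial>lborel)"
    using assms norm_wave_sum_le[OF \<open>finite K\<close>, of s \<alpha>]
    by (intro nn_integral_mono)
      (auto simp: fejer_nonneg simp flip: ennreal_mult powr_mult intro!: ennreal_leI powr_mono2)
  also have "\<dots> = ennreal (real (card K) powr p) * (ennreal (1 / s) * weighted_int p 0)"
    using assms nn_integral_scale[of s "\<lambda>x. ennreal (fejer (x / 4) powr p)"]
    by (simp add: nn_integral_cmult weighted_int_def riesz_0)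
  also have "\<dots> < \<infinity>" using weighted_int_0_finite[of p] assms by (simp add: ennreal_mult_less_top)
  finally show ?thesis by (simp add: Lp_space_iff)
qed

lemma bump_sum_L2:
  assumes "finite K" "s > 0"
  shows "fourier_L1 (wave_sum s \<alpha> K) \<in> Lp_space 2"
proof -
  define C where "C = 4 / s * \<bar>fejer_mass\<bar>"
  have "C \<ge> 0" using assms by (simp add: C_def)
  \<comment> \<open>Outside [-R, R] the distance to every centre exceeds \<open>s\<close>, so all
    bumps vanish there.\<close>
  define R where "R = (\<Sum>k\<in>K. \<bar>\<alpha> k\<bar>) + s"
  have bound: "norm (\<Sum>k\<in>K. bump s (\<alpha> k) \<xi>) powr 2 \<le> (real (card K) * C) powr 2 * indicator {-R..R} \<xi>" for \<xi>
  proof (cases "\<xi> \<in> {-R..R}")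
    case True
    have "norm (bump s (\<alpha> k) \<xi>) \<le> C" for k
    proof -
      have "norm (bump s (\<alpha> k) \<xi>) = C * max 0 (1 - \<bar>4 * (\<xi> - \<alpha> k) / s\<bar>)"
        unfolding bump_def C_def norm_of_real abs_mult using assms by simp
      also have "\<dots> \<le> C * 1" using \<open>C \<ge> 0\<close> by (intro mult_left_mono) auto
      finally show ?thesis by simp
    qed
    then have "norm (\<Sum>k\<in>K. bump s (\<alpha> k) \<xi>) \<le> real (card K) * C"
      by (rule sum_norm_bound)
    then show ?thesis using True by (auto intro!: powr_mono2 simp del: powr_numeral)
  next
    case False
    have "bump s (\<alpha> k) \<xi> = 0" if "k \<in> K" for k
    proof (rule bump_eq_0[OF \<open>s > 0\<close>])
      have "\<bar>\<alpha> k\<bar> \<le> (\<Sum>k\<in>K. \<bar>\<alpha> k\<bar>)" using that assms by (intro member_le_sum) auto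
      then show "\<bar>\<xi> - \<alpha> k\<bar> \<ge> s / 4" using False \<open>s > 0\<close> unfolding R_def by auto
    qed
    then show ?thesis by simp
  qed
  have "(\<integral>\<^sup>+\<xi>. ennreal (norm (\<Sum>k\<in>K. bump s (\<alpha> k) \<xi>) powr 2) \<partial>lborel)
      \<le> (\<integral>\<^sup>+\<xi>. ennreal ((real (card K) * C) powr 2) * indicator {-R..R} \<xi> \<partial>lborel)"
  proof (rule nn_integral_mono)
    fix \<xi>
    show "ennreal (norm (\<Sum>k\<in>K. bump s (\<alpha> k) \<xi>) powr 2) \<le> ennreal ((real (card K) * C) powr 2) * indicator {-R..R} \<xi>"
      using ennreal_leI[OF bound[of \<xi>]] by (auto simp: indicator_def)
  qed
  also have "\<dots> < \<infinity>" by (simp add: nn_integral_cmult emeasure_lborel_Icc_eq ennreal_mult_less_top)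
  finally have "(\<lambda>\<xi>. \<Sum>k\<in>K. bump s (\<alpha> k) \<xi>) \<in> Lp_space 2"
    by (simp add: Lp_space_iff bump_def)
  moreover have "fourier_L1 (wave_sum s \<alpha> K) = (\<lambda>\<xi>. \<Sum>k\<in>K. bump s (\<alpha> k) \<xi>)"
    using assms by (intro ext fourier_wave_sum)
  ultimately show ?thesis by simp
qed

text \<open>Each bump lives entirely inside or entirely outside \<open>I\<close>, so multiplying by
  the indicator of \<open>I\<close> just selects the bumps with centre in \<open>I\<close>.\<close>

lemma freq_restr_wave_sum:
  assumes "finite K" "s > 0" "p \<ge> 1"
    and sep: "\<And>k. k \<in> K \<Longrightarrow> {\<alpha> k - s / 4<..<\<alpha> k + s / 4} \<subseteq> I \<or> {\<alpha> k - s / 4<..<\<alpha> k + s / 4} \<inter> I = {}"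
  shows "freq_restr p I (wave_sum s \<alpha> K) (wave_sum s \<alpha> {k\<in>K. \<alpha> k \<in> I})"
proof -
  have "(\<Sum>k\<in>{k\<in>K. \<alpha> k \<in> I}. bump s (\<alpha> k) \<xi>) = indicator I \<xi> * (\<Sum>k\<in>K. bump s (\<alpha> k) \<xi>)" for \<xi>
  proof -
    have "(if \<alpha> k \<in> I then bump s (\<alpha> k) \<xi> else 0) = indicator I \<xi> * bump s (\<alpha> k) \<xi>" if "k \<in> K" for k
    proof (cases "\<xi> \<in> {\<alpha> k - s / 4<..<\<alpha> k + s / 4}")
      case True
      moreover have "\<alpha> k \<in> {\<alpha> k - s / 4<..<\<alpha> k + s / 4}" using \<open>s > 0\<close> by simp
      ultimately have "\<alpha> k \<in> I \<longleftrightarrow> \<xi> \<in> I" using sep[OF that] by blast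
      then show ?thesis by simp
    next
      case False
      then have "bump s (\<alpha> k) \<xi> = 0" by (intro bump_eq_0 \<open>s > 0\<close>) (auto simp: abs_if)
      then show ?thesis by simp
    qed
    then show ?thesis
      using \<open>finite K\<close> by (simp add: sum_distrib_left sum.inter_filter)
  qed
  then show ?thesis
    using assms by (intro freq_restr_of_L1 wave_sum_Lp bump_sum_L2) (auto simp: fourier_wave_sum)
qed

text \<open>Every component contains at most one centre. Its term is therefore 0 or the square of
  one kernel, which is independent of the centre since modulation preserves the modulus.\<close>

lemma square_fun_wave_sum:
  assumes "finite K" and inj: "inj_on C K" and C: "\<And>k. k \<in> K \<Longrightarrow> C k \<in> \<I> \<and> \<alpha> k \<in> C k"
    and disj: "disjoint \<I>"
  shows "square_fun \<I> (\<lambda>I. wave_sum s \<alpha> {k\<in>K. \<alpha> k \<in> I}) x = ennreal (sqrt (real (card K)) * fejer (s * x / 4))"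
proof -
  let ?h = "\<lambda>I. wave_sum s \<alpha> {k\<in>K. \<alpha> k \<in> I} x"
  have mem: "{k\<in>K. \<alpha> k \<in> I} = {k\<in>K. C k = I}" if "I \<in> \<I>" for I
    using C disj that by (auto simp: pairwise_def disjnt_iff)
  have zero: "?h I = 0" if "I \<in> \<I> - C ` K" for I
  proof -
    have "{k\<in>K. \<alpha> k \<in> I} = {}" using that mem[of I] by auto
    then show ?thesis by (simp only: wave_sum_def sum.empty)
  qed
  have one: "norm (?h (C k)) = fejer (s * x / 4)" if "k \<in> K" for k
  proof -
    have "{j\<in>K. \<alpha> j \<in> C k} = {k}"
      using mem[of "C k"] C[OF that] that inj by (auto simp: inj_on_def)
    then show ?thesis by (simp add: wave_sum_def norm_wave)
  qed
  have "(\<Sum>\<^sub>\<infinity>I\<in>\<I>. (ennreal (norm (?h I)))\<^sup>2) = (\<Sum>\<^sub>\<infinity>I\<in>C ` K. (ennreal (norm (?h I)))\<^sup>2)"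
    using C zero by (intro infsum_cong_neutral) auto
  also have "\<dots> = (\<Sum>I\<in>C ` K. (ennreal (norm (?h I)))\<^sup>2)"
    using \<open>finite K\<close> by (intro infsum_finite) auto
  also have "\<dots> = (\<Sum>k\<in>K. (ennreal (norm (?h (C k))))\<^sup>2)"
    using inj by (simp add: sum.reindex)
  also have "\<dots> = (\<Sum>k\<in>K. ennreal ((fejer (s * x / 4))\<^sup>2))"
    by (intro sum.cong refl) (simp only: one ennreal_power fejer_nonneg)
  also have "\<dots> = ennreal (real (card K) * (fejer (s * x / 4))\<^sup>2)"
    by (simp add: ennreal_mult ennreal_of_nat_eq_real_of_nat)
  finally have "square_fun \<I> (\<lambda>I. wave_sum s \<alpha> {k\<in>K. \<alpha> k \<in> I}) x
      = ennreal ((real (card K) * (fejer (s * x / 4))\<^sup>2) powr (1/2))"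
    by (simp add: square_fun_def epowr_ennreal)
  also have "(real (card K) * (fejer (s * x / 4))\<^sup>2) powr (1/2) = sqrt (real (card K)) * fejer (s * x / 4)"
    by (simp add: powr_half_sqrt real_sqrt_mult fejer_nonneg)
  finally show ?thesis .
qed

section \<open>Failure of the Littlewood-Paley inequalities\<close>

text \<open>All that the failure of LP requires of \<open>E\<close>: a copy of
  \<open>C\<^sub>n\<close> with spacing \<open>s\<close> and a free interval of length
  \<open>s\<close> to the right of each point. The components may be longer than these intervals,
  but must be distinct.\<close>

definition spread_gaps :: "real set \<Rightarrow> nat \<Rightarrow> real \<Rightarrow> real \<Rightarrow> bool" where
  "spread_gaps E n s b \<longleftrightarrow> (\<exists>C. inj_on C {..<2 ^ n} \<and>
     (\<forall>m<2 ^ n. C m \<in> components (- E) \<and> {b + s * real (spread m)<..<b + s * real (spread m) + s} \<subseteq> C m))"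

text \<open>The phase coming from \<open>b + s / 2\<close> is common to all waves and has modulus 1;
  what remains is the exponential sum of \<open>riesz\<close> at \<open>s * x\<close>, with its
  normalization undone.\<close>

lemma norm_wave_sum_spread:
  "norm (wave_sum s (\<lambda>m. b + s * real (spread m) + s / 2) {..<2 ^ n} x)
    = fejer (s * x / 4) * sqrt (2 ^ n * riesz n (s * x))"
proof -
  have "wave s (b + s * real (spread m) + s / 2) x
      = (of_real (fejer (s * x / 4)) * cis ((b + s / 2) * x)) * cis (real (spread m) * (s * x))" for m
  proof -
    have "(b + s * real (spread m) + s / 2) * x = (b + s / 2) * x + real (spread m) * (s * x)"
      by (simp add: algebra_simps)
    then show ?thesis unfolding wave_def by (simp only: cis_mult[symmetric] mult_ac)
  qed
  then have "wave_sum s (\<lambda>m. b + s * real (spread m) + s / 2) {..<2 ^ n} x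
      = (of_real (fejer (s * x / 4)) * cis ((b + s / 2) * x)) * (\<Sum>m<2 ^ n. cis (real (spread m) * (s * x)))"
    by (simp only: wave_sum_def sum_distrib_left)
  then show ?thesis
    by (simp add: norm_mult fejer_nonneg riesz_def real_sqrt_divide)
qed

lemma Lp_norm_wave_sum_spread:
  assumes "s > 0" "p > 0"
  shows "Lp_norm p (wave_sum s (\<lambda>m. b + s * real (spread m) + s / 2) {..<2 ^ n})
    = epowr (ennreal ((2 ^ n) powr (p / 2) / s) * weighted_int p n) (1 / p)"
proof -
  have "(\<integral>\<^sup>+x. ennreal (norm (wave_sum s (\<lambda>m. b + s * real (spread m) + s / 2) {..<2 ^ n} x) powr p) \<partial>lborel)
      = (\<integral>\<^sup>+x. ennreal ((2 ^ n) powr (p / 2)) * ennreal (fejer (s * x / 4) powr p * riesz n (s * x) powr (p / 2)) \<partial>lborel)"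
    by (intro nn_integral_cong) (simp add: norm_wave_sum_spread fejer_nonneg riesz_nonneg
        powr_mult powr_powr mult_ac flip: powr_half_sqrt ennreal_mult)
  also have "\<dots> = ennreal ((2 ^ n) powr (p / 2)) * (ennreal (1 / s) * weighted_int p n)"
    using assms nn_integral_scale[of s "\<lambda>x. ennreal (fejer (x / 4) powr p * riesz n x powr (p / 2))"]
    by (simp add: nn_integral_cmult weighted_int_def)
  also have "\<dots> = ennreal ((2 ^ n) powr (p / 2) / s) * weighted_int p n"
    using assms by (simp flip: mult.assoc ennreal_mult)
  finally show ?thesis by (simp only: Lp_norm_alt)
qed

lemma Lp_enorm_fejer:
  assumes "s > 0" "p > 0"
  shows "Lp_enorm p (\<lambda>x. ennreal (sqrt (2 ^ n) * fejer (s * x / 4)))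
    = epowr (ennreal ((2 ^ n) powr (p / 2) / s) * weighted_int p 0) (1 / p)"
proof -
  have "(\<integral>\<^sup>+x. epowr (ennreal (sqrt (2 ^ n) * fejer (s * x / 4))) p \<partial>lborel)
      = (\<integral>\<^sup>+x. ennreal ((2 ^ n) powr (p / 2)) * ennreal (fejer (s * x / 4) powr p) \<partial>lborel)"
    by (intro nn_integral_cong) (simp add: epowr_ennreal fejer_nonneg
        powr_mult powr_powr flip: powr_half_sqrt ennreal_mult)
  also have "\<dots> = ennreal ((2 ^ n) powr (p / 2)) * (ennreal (1 / s) * weighted_int p 0)"
    using assms nn_integral_scale[of s "\<lambda>x. ennreal (fejer (x / 4) powr p)"]
    by (simp add: nn_integral_cmult weighted_int_def riesz_0)
  also have "\<dots> = ennreal ((2 ^ n) powr (p / 2) / s) * weighted_int p 0"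
    using assms by (simp flip: mult.assoc ennreal_mult)
  finally show ?thesis by (simp only: Lp_enorm_def)
qed

text \<open>The two norms contain the same factor depending on \<open>n\<close> and
  \<open>s\<close>. It cancels after taking p-th powers, which leaves constants independent of
  \<open>n\<close>.\<close>

lemma has_LP_weighted_int:
  assumes LP: "has_LP p E" and "p > 1" and gaps: "\<And>n. \<exists>s b. s > 0 \<and> spread_gaps E n s b"
  shows "\<exists>c1 c2. c1 > 0 \<and> c2 > 0 \<and>
    (\<forall>n. ennreal c1 * weighted_int p n \<le> weighted_int p 0 \<and> weighted_int p 0 \<le> ennreal c2 * weighted_int p n)"
proof -
  obtain c1 c2 where c: "c1 > 0" "c2 > 0"
    and *: "\<And>f h. f \<in> Lp_space p \<Longrightarrow> (\<And>I. I \<in> components (- E) \<Longrightarrow> freq_restr p I f (h I)) \<Longrightarrow>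
         ennreal c1 * Lp_norm p f \<le> Lp_enorm p (square_fun (components (- E)) h) \<and>
         Lp_enorm p (square_fun (components (- E)) h) \<le> ennreal c2 * Lp_norm p f"
    using LP unfolding has_LP_def by metis
  have "ennreal (c1 powr p) * weighted_int p n \<le> weighted_int p 0 \<and> weighted_int p 0 \<le> ennreal (c2 powr p) * weighted_int p n" for n
  proof -
    obtain s b :: real and C where "s > 0" and inj: "inj_on C {..<2 ^ n}"
      and C: "\<And>m. m < 2 ^ n \<Longrightarrow> C m \<in> components (- E)"
      and sub: "\<And>m. m < 2 ^ n \<Longrightarrow> {b + s * real (spread m)<..<b + s * real (spread m) + s} \<subseteq> C m"
      using gaps[of n] unfolding spread_gaps_def by metis
    define \<alpha> where "\<alpha> = (\<lambda>m. b + s * real (spread m) + s / 2)"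
    define f where "f = wave_sum s \<alpha> {..<2 ^ n}"
    define h where "h = (\<lambda>I. wave_sum s \<alpha> {m\<in>{..<2 ^ n}. \<alpha> m \<in> I})"
    have disj: "disjoint (components (- E))"
      using pairwise_disjoint_components[of "- E"] by (auto simp: pairwise_def disjnt_def)
    have sub': "{\<alpha> m - s / 4<..<\<alpha> m + s / 4} \<subseteq> C m" "\<alpha> m \<in> C m" if "m < 2 ^ n" for m
      using sub[OF that] \<open>s > 0\<close> by (auto simp: \<alpha>_def subset_iff)
    have "freq_restr p I f (h I)" if "I \<in> components (- E)" for I
      unfolding f_def h_def
    proof (rule freq_restr_wave_sum)
      fix m :: nat assume m: "m \<in> {..<2 ^ n}"
      show "{\<alpha> m - s / 4<..<\<alpha> m + s / 4} \<subseteq> I \<or> {\<alpha> m - s / 4<..<\<alpha> m + s / 4} \<inter> I = {}"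
        using components_eq[OF C that, of m] sub'(1)[of m] m by blast
    qed (use \<open>s > 0\<close> \<open>p > 1\<close> in auto)
    moreover have "f \<in> Lp_space p"
      unfolding f_def using \<open>s > 0\<close> \<open>p > 1\<close> by (intro wave_sum_Lp) auto
    ultimately have ineq: "ennreal c1 * Lp_norm p f \<le> Lp_enorm p (square_fun (components (- E)) h)"
         "Lp_enorm p (square_fun (components (- E)) h) \<le> ennreal c2 * Lp_norm p f"
      using * by blast+
    have "square_fun (components (- E)) h = (\<lambda>x. ennreal (sqrt (2 ^ n) * fejer (s * x / 4)))"
      unfolding h_def using square_fun_wave_sum[OF _ inj, of "components (- E)" \<alpha> s] C sub'(2) disj by auto
    then have S: "Lp_enorm p (square_fun (components (- E)) h)
        = epowr (ennreal ((2 ^ n) powr (p / 2) / s) * weighted_int p 0) (1 / p)"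
      using Lp_enorm_fejer \<open>s > 0\<close> \<open>p > 1\<close> by simp
    have F: "Lp_norm p f = epowr (ennreal ((2 ^ n) powr (p / 2) / s) * weighted_int p n) (1 / p)"
      unfolding f_def \<alpha>_def using Lp_norm_wave_sum_spread \<open>s > 0\<close> \<open>p > 1\<close> by simp
    define K where "K = ennreal ((2 ^ n) powr (p / 2) / s)"
    \<comment> \<open>Both facts are required to cancel \<open>K\<close> in extended
      arithmetic.\<close>
    have K: "K \<noteq> 0" "K \<noteq> top" using \<open>s > 0\<close> by (auto simp: K_def)
    have "ennreal (c1 powr p) * (K * weighted_int p n) \<le> K * weighted_int p 0"
      "K * weighted_int p 0 \<le> ennreal (c2 powr p) * (K * weighted_int p n)"
      using ineq \<open>p > 1\<close> c unfolding S F K_def[symmetric]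
      by (simp_all add: epowr_le_iff flip: epowr_scale)
    then show ?thesis
      unfolding mult.left_commute[of _ K] ennreal_mult_le_mult_iff[OF K] by simp
  qed
  then show ?thesis using c
    by (intro exI[of _ "c1 powr p"] exI[of _ "c2 powr p"]) auto
qed

text \<open>For p > 2 the norms of the test functions outgrow their square functions, against the
  lower inequality. For p < 2 they become too small, against the upper one.\<close>

lemma not_has_LP:
  assumes "p > 1" "p \<noteq> 2" and gaps: "\<And>n. \<exists>s b. s > 0 \<and> spread_gaps E n s b"
  shows "\<not> has_LP p E"
proof
  assume "has_LP p E"
  from has_LP_weighted_int[OF this \<open>p > 1\<close> gaps] obtain c1 c2
    where c: "c1 > 0" "c2 > 0"
      and le: "\<And>n. ennreal c1 * weighted_int p n \<le> weighted_int p 0"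
        "\<And>n. weighted_int p 0 \<le> ennreal c2 * weighted_int p n"
    by blast
  have inv: "ennreal (1 / c) * (ennreal c * x) = x" if "c > 0" for c x
    using that by (simp flip: mult.assoc ennreal_mult)
  consider "p > 2" | "p < 2" using assms by linarith
  then show False
  proof cases
    case 1
    have "ennreal (1 / c1) * weighted_int p 0 < \<infinity>"
      using weighted_int_0_finite[of p] \<open>p > 1\<close> by (simp add: ennreal_mult_less_top)
    then obtain n where "ennreal (1 / c1) * weighted_int p 0 < weighted_int p n"
      using weighted_int_unbounded[OF 1] by blast
    moreover have "weighted_int p n \<le> ennreal (1 / c1) * weighted_int p 0"
      using mult_left_mono[OF le(1)[of n], of "ennreal (1 / c1)"] inv c by simp
    ultimately show False by simp
  next
    case 2
    have "ennreal (1 / c2) * weighted_int p 0 > 0"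
      using weighted_int_0_pos[of p] \<open>p > 1\<close> c by (simp add: ennreal_zero_less_mult_iff)
    then obtain n where "weighted_int p n < ennreal (1 / c2) * weighted_int p 0"
      using weighted_int_small[OF \<open>p > 1\<close> 2] by blast
    moreover have "ennreal (1 / c2) * weighted_int p 0 \<le> weighted_int p n"
      using mult_left_mono[OF le(2)[of n], of "ennreal (1 / c2)"] inv c by simp
    ultimately show False by simp
  qed
qed

section \<open>The sequence\<close>

text \<open>Block \<open>n\<close> has length at most 4^(-t n), and leaving \<open>t\<close> free
  lets the blocks shrink as fast as desired. The condition on \<open>t 0\<close> keeps the sequence
  in [0, 1/2].\<close>

locale spread_blocks =
  fixes t :: "nat \<Rightarrow> nat"
  assumes t_mono: "strict_mono t" and t_0: "t 0 \<ge> 1"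
begin

definition unit :: "nat \<Rightarrow> real" where "unit n = 1 / 4 ^ t n"

text \<open>Below \<open>unit n\<close> there is room for \<open>n\<close> base-4 digits, those of
  \<open>spread m\<close> with \<open>m < 2 ^ n\<close>.\<close>

definition step :: "nat \<Rightarrow> real" where "step n = 1 / 4 ^ (t n + n)"

definition start :: "nat \<Rightarrow> real" where "start n = (\<Sum>j<n. unit j)"

definition pt :: "nat \<Rightarrow> nat \<Rightarrow> real" where "pt n m = start n + step n * real (spread m)"

text \<open>Position \<open>2\<^sup>n - 1 + m\<close> with \<open>m < 2\<^sup>n\<close> is the \<open>m\<close>-th point of block \<open>n\<close>.\<close>

definition a :: "nat \<Rightarrow> real" where
  "a k = (let n = floor_log (Suc k) in pt n (Suc k - 2 ^ n))"

lemma a_eq: "Suc k = 2 ^ n + m \<Longrightarrow> m < 2 ^ n \<Longrightarrow> a k = pt n m"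
proof -
  assume k: "Suc k = 2 ^ n + m" "m < 2 ^ n"
  then have "floor_log (Suc k) = n" by (intro floor_log_eqI) auto
  then show ?thesis using k by (simp add: a_def)
qed

lemma block_cases:
  obtains n m where "Suc k = 2 ^ n + m" "m < 2 ^ n" "a k = pt n m"
proof -
  define n where "n = floor_log (Suc k)"
  have "2 ^ n \<le> Suc k" "Suc k < 2 * 2 ^ n"
    unfolding n_def using floor_log_exp2_le[of "Suc k"] floor_log_exp2_gt[of "Suc k"] by auto
  then have "Suc k = 2 ^ n + (Suc k - 2 ^ n)" "Suc k - 2 ^ n < 2 ^ n" by auto
  then show ?thesis using that a_eq by blast
qed

lemma unit_pos: "unit n > 0" by (simp add: unit_def)

lemma step_pos: "step n > 0" by (simp add: step_def)

lemma unit_eq_step: "unit n = step n * 4 ^ n" by (simp add: unit_def step_def power_add)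

lemma unit_Suc: "unit (Suc n) \<le> unit n / 4"
proof -
  have "4 * 4 ^ t n \<le> (4 :: real) ^ t (Suc n)"
    using power_increasing[of "Suc (t n)" "t (Suc n)" "4 :: real"] strict_monoD[OF t_mono, of n "Suc n"] by simp
  then show ?thesis by (simp add: unit_def field_simps)
qed

lemma pt_bounds:
  assumes "m < 2 ^ n"
  shows "start n \<le> pt n m" "pt n m + step n \<le> start (Suc n)" "pt n m \<le> start n + unit n"
proof -
  have "real (spread m + 1) \<le> real (4 ^ n)"
    using spread_less_power[OF assms] by (simp only: of_nat_le_iff)
  then have "real (spread m) + 1 \<le> 4 ^ n" by simp
  from mult_left_mono[OF this less_imp_le[OF step_pos[of n]]]
  have "step n * real (spread m) + step n \<le> unit n" by (simp add: unit_eq_step algebra_simps)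
  then show "pt n m + step n \<le> start (Suc n)" "pt n m \<le> start n + unit n"
    using step_pos[of n] by (auto simp: pt_def start_def)
  show "start n \<le> pt n m" using step_pos[of n] by (simp add: pt_def)
qed

text \<open>Within a block \<open>spread\<close> increases by at least 1. At the end of a block,
  \<open>spread m + 1 \<le> 4 ^ n\<close> leaves one more step before the next block starts.\<close>

lemma a_gap:
  assumes "Suc k = 2 ^ n + m" "m < 2 ^ n"
  shows "a k + step n \<le> a (Suc k)"
proof (cases "Suc m < 2 ^ n")
  case True
  have "a (Suc k) = pt n (Suc m)" using True assms by (intro a_eq) auto
  moreover have "real (spread m) + 1 \<le> real (spread (Suc m))" using spread_Suc_less[of m] by linarith
  from mult_left_mono[OF this less_imp_le[OF step_pos[of n]]]
  have "pt n m + step n \<le> pt n (Suc m)" by (simp add: pt_def algebra_simps)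
  ultimately show ?thesis using a_eq[OF assms] by simp
next
  case False
  then have "a (Suc k) = pt (Suc n) 0" using assms by (intro a_eq) auto
  then show ?thesis using pt_bounds(2)[OF assms(2)] a_eq[OF assms] by (simp add: pt_def)
qed

lemma strict_mono_a: "strict_mono a"
  unfolding strict_mono_Suc_iff
proof
  fix k
  obtain n m where "Suc k = 2 ^ n + m" "m < 2 ^ n" by (rule block_cases)
  from a_gap[OF this] step_pos[of n] show "a k < a (Suc k)" by simp
qed

lemma start_mono: "n \<le> n' \<Longrightarrow> start n \<le> start n'"
  unfolding start_def using unit_pos less_imp_le by (intro sum_mono2) auto

text \<open>Right end for block \<open>n\<close> and all later ones. As \<open>unit\<close> drops at
  least by the factor 4 each time, twice \<open>unit n\<close> exceeds the total of the remaining
  lengths.\<close>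

definition upper :: "nat \<Rightarrow> real" where "upper n = start n + 2 * unit n"

lemma upper_antimono: "n \<le> n' \<Longrightarrow> upper n' \<le> upper n"
proof (induction n' rule: dec_induct)
  case (step n')
  have "upper (Suc n') \<le> upper n'"
    using unit_Suc[of n'] unit_pos[of n'] by (simp add: upper_def start_def)
  then show ?case using step by simp
qed simp

lemma a_bounds:
  assumes "2 ^ N \<le> Suc k"
  shows "start N \<le> a k" "a k \<le> upper N"
proof -
  obtain n m where k: "Suc k = 2 ^ n + m" "m < 2 ^ n" "a k = pt n m" by (rule block_cases)
  have "(2::nat) ^ N < 2 ^ Suc n" using assms k by simp
  then have "N \<le> n" using power_less_imp_less_exp[of "2::nat" N "Suc n"] by simp
  then show "start N \<le> a k" "a k \<le> upper N"
    using start_mono[of N n] upper_antimono[of N n] pt_bounds[OF k(2)] unit_pos[of n]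
    unfolding k(3) upper_def by linarith+
qed

lemma a_range: "0 \<le> a k" "a k \<le> 1/2"
proof -
  have "(4::real) ^ 1 \<le> 4 ^ t 0" by (rule power_increasing) (use t_0 in auto)
  then have "upper 0 \<le> 1/2" by (simp add: upper_def start_def unit_def field_simps)
  then show "0 \<le> a k" "a k \<le> 1/2" using a_bounds[of 0 k] by (auto simp: start_def)
qed

lemma bounded_range_a: "bounded (range a)"
  by (rule bounded_subset[OF bounded_closed_interval[of 0 "1/2"]]) (use a_range in auto)

lemma a_LIMSEQ: "a \<longlonglongrightarrow> lim a"
  using strict_mono_a a_range by (intro convergent_LIMSEQ_iff[THEN iffD1] Bseq_mono_convergent)
    (auto simp: strict_mono_less_eq intro!: BseqI'[of _ "1/2"])

lemma a_less_lim: "a k < lim a"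
proof -
  have "a (Suc k) \<le> lim a"
    using a_LIMSEQ strict_mono_a by (intro incseq_le) (auto simp: strict_mono_mono)
  then show ?thesis using strict_monoD[OF strict_mono_a, of k "Suc k"] by simp
qed

lemma lim_bounds: "start N \<le> lim a" "lim a \<le> upper N"
proof -
  have "start N \<le> a (2 ^ N - 1)" using a_bounds(1)[of N "2 ^ N - 1"] by simp
  then show "start N \<le> lim a" using a_less_lim[of "2 ^ N - 1"] by simp
  show "lim a \<le> upper N"
  proof (rule LIMSEQ_le_const2[OF a_LIMSEQ], intro exI allI impI)
    fix k :: nat assume "2 ^ N \<le> k"
    then show "a k \<le> upper N" using a_bounds(2)[of N k] by simp
  qed
qed

section \<open>The complementary intervals of the set\<close>

definition pts :: "real set" where "pts = range a \<union> {lim a}"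

lemma gap_component: "{a k<..<a (Suc k)} \<in> components (- pts)"
  unfolding in_components_maximal
proof (intro conjI allI impI)
  show "{a k<..<a (Suc k)} \<noteq> {}"
    using strict_monoD[OF strict_mono_a, of k "Suc k"] by simp
  show sub: "{a k<..<a (Suc k)} \<subseteq> - pts"
  proof
    fix x assume x: "x \<in> {a k<..<a (Suc k)}"
    have "x \<noteq> a l" for l
    proof
      assume "x = a l"
      with x have "k < l" "l < Suc k" using strict_mono_less[OF strict_mono_a] by auto
      then show False by simp
    qed
    moreover have "x \<noteq> lim a" using x a_less_lim[of "Suc k"] by auto
    ultimately show "x \<in> - pts" by (auto simp: pts_def)
  qed
  show "connected {a k<..<a (Suc k)}" by simp
  fix D assume D: "D \<noteq> {} \<and> {a k<..<a (Suc k)} \<subseteq> D \<and> D \<subseteq> - pts \<and> connected D"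
  have out: "a k \<notin> D" "a (Suc k) \<notin> D" using D by (auto simp: pts_def)
  \<comment> \<open>Midpoint of the gap. A connected set reaching from here beyond the gap would
    contain an endpoint, and the endpoints belong to \<open>pts\<close>.\<close>
  define c where "c = (a k + a (Suc k)) / 2"
  have c: "a k < c" "c < a (Suc k)"
    using strict_monoD[OF strict_mono_a, of k "Suc k"] by (auto simp: c_def)
  then have "c \<in> D" using D by auto
  have iv: "y \<in> D" if "u \<in> D" "v \<in> D" "u \<le> y" "y \<le> v" for u v y
    using D that connectedD_interval[of D u v y] by auto
  have "D \<subseteq> {a k<..<a (Suc k)}"
  proof
    fix x assume "x \<in> D"
    show "x \<in> {a k<..<a (Suc k)}"
      using iv[OF \<open>x \<in> D\<close> \<open>c \<in> D\<close>, of "a k"] iv[OF \<open>c \<in> D\<close> \<open>x \<in> D\<close>, of "a (Suc k)"] out c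
      by (force simp: not_less)
  qed
  then show "D = {a k<..<a (Suc k)}" using D by auto
qed

lemma spread_gaps_pts: "spread_gaps pts n (step n) (start n)"
  unfolding spread_gaps_def
proof (intro exI conjI allI impI)
  define C where "C = (\<lambda>m. {a (2 ^ n + m - 1)<..<a (Suc (2 ^ n + m - 1))})"
  show "inj_on C {..<2 ^ n}"
  proof (rule inj_onI)
    fix m m' assume "C m = C m'"
    \<comment> \<open>A gap determines its left endpoint, hence its index.\<close>
    then have "Inf (C m) = Inf (C m')" by simp
    then have "a (2 ^ n + m - 1) = a (2 ^ n + m' - 1)"
      unfolding C_def using strict_monoD[OF strict_mono_a lessI]
      by (simp only: cInf_greaterThanLessThan)
    then have "2 ^ n + m - 1 = 2 ^ n + m' - 1" using strict_mono_eq[OF strict_mono_a] by blast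
    moreover have "(2::nat) ^ n \<ge> 1" by simp
    ultimately show "m = m'" by linarith
  qed
  fix m :: nat assume m: "m < 2 ^ n"
  show "C m \<in> components (- pts)" unfolding C_def by (rule gap_component)
  \<comment> \<open>Block \<open>n\<close> begins at index \<open>2 ^ n - 1\<close>, since the
    blocks before it hold that many points.\<close>
  have k: "Suc (2 ^ n + m - 1) = 2 ^ n + m" by simp
  have "a (2 ^ n + m - 1) = start n + step n * real (spread m)"
    using a_eq[OF k m] by (simp add: pt_def)
  then show "{start n + step n * real (spread m)<..<start n + step n * real (spread m) + step n} \<subseteq> C m"
    using a_gap[OF k m] unfolding C_def by auto
qed

section \<open>Base-4 digits of the points and porosity\<close>

lemma start_spread: "\<exists>M. start n = real (spread M) / 4 ^ (case n of 0 \<Rightarrow> 0 | Suc i \<Rightarrow> t i)"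
proof (induction n)
  case 0
  show ?case by (intro exI[of _ 0]) (simp add: start_def)
next
  case (Suc n)
  \<comment> \<open>Position of the last digit 1 of \<open>start n\<close>, or 0 for the empty
    sum.\<close>
  define T where "T = (case n of 0 \<Rightarrow> 0 | Suc i \<Rightarrow> t i)"
  obtain M where M: "start n = real (spread M) / 4 ^ T" using Suc unfolding T_def by blast
  have T: "T < t n" unfolding T_def using t_0 strict_monoD[OF t_mono] by (auto split: nat.split)
  define d where "d = t n - T"
  have "(1::nat) < 2 ^ d" using T by (intro one_less_power) (auto simp: d_def)
  from spread_append[OF this, of M]
  have e: "real (spread (2 ^ d * M + 1)) = 4 ^ d * real (spread M) + 1" by simp
  have "(4::real) ^ t n = 4 ^ d * 4 ^ T" using T by (simp add: d_def flip: power_add)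
  moreover have "start (Suc n) = start n + 1 / 4 ^ t n" by (simp add: start_def unit_def)
  ultimately have "start (Suc n) = real (spread (2 ^ d * M + 1)) / 4 ^ t n"
    unfolding e M by (simp add: field_simps)
  then show ?case by (intro exI[of _ "2 ^ d * M + 1"]) simp
qed

text \<open>The digits of \<open>m\<close> occupy the positions \<open>t n + 1\<close> to
  \<open>t n + n\<close>, behind all digits of \<open>start n\<close>, so that the addition produces
  no carry.\<close>

lemma a_spread: "\<exists>N T. a k = real (spread N) / 4 ^ T"
proof -
  obtain n m where k: "Suc k = 2 ^ n + m" "m < 2 ^ n" "a k = pt n m" by (rule block_cases)
  let ?T = "case n of 0 \<Rightarrow> 0 | Suc i \<Rightarrow> t i"
  obtain M where M: "start n = real (spread M) / 4 ^ ?T" using start_spread by blast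
  have T: "?T < t n" using t_0 strict_monoD[OF t_mono] by (auto split: nat.split)
  define d where "d = t n + n - ?T"
  have "(2::nat) ^ n \<le> 2 ^ d" using T by (intro power_increasing) (auto simp: d_def)
  with k(2) have "m < 2 ^ d" by (rule less_le_trans)
  from spread_append[OF this, of M]
  have "real (spread (2 ^ d * M + m)) = 4 ^ d * real (spread M) + real (spread m)" by simp
  moreover have "(4::real) ^ (t n + n) = 4 ^ d * 4 ^ ?T"
    using T by (simp add: d_def flip: power_add)
  ultimately have "real (spread (2 ^ d * M + m)) / 4 ^ (t n + n) = pt n m"
    by (simp add: M pt_def step_def field_simps)
  then show ?thesis using k(3) by metis
qed

text \<open>Geometrically: in the grid of multiples of \<open>r\<close>, the open right half of
  every cell is free of points of the sequence.\<close>

definition good_scale :: "real \<Rightarrow> bool" where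
  "good_scale r \<longleftrightarrow> r > 0 \<and> (\<forall>(j::int) k. \<not> (of_int j + 1/2 < a k / r \<and> a k / r < of_int j + 1))"

text \<open>All points lie in [0, 1/2], so for large \<open>r\<close> the quotients stay in the left
  half of a single cell.\<close>

lemma good_scale_ge_1:
  assumes "r \<ge> 1"
  shows "good_scale r"
proof -
  have "\<not> (of_int j + 1/2 < a k / r \<and> a k / r < of_int j + 1)" for j :: int and k
  proof -
    have "a k \<le> 1/2 * r" using a_range(2)[of k] assms by linarith
    then have "0 \<le> a k / r" "a k / r \<le> 1/2" using a_range(1)[of k] assms by (auto simp: field_simps)
    moreover have "0 \<le> real_of_int j \<or> real_of_int j + 1 \<le> 0"
    proof (cases "0 \<le> j")
      case False
      then have "real_of_int (j + 1) \<le> 0" by (simp only: of_int_le_0_iff)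
      then show ?thesis by simp
    qed simp
    ultimately show ?thesis by (intro notI, elim conjE disjE) linarith+
  qed
  then show ?thesis using assms by (simp add: good_scale_def)
qed

lemma good_scale_power: "good_scale ((1/4) ^ i)"
proof -
  have eq: "a k / (1/4) ^ i = 4 ^ i * a k" for k by (simp add: power_one_over)
  show ?thesis unfolding good_scale_def
  proof (intro conjI allI)
    fix j :: int and k
    obtain N T where "a k = real (spread N) / 4 ^ T" using a_spread by blast
    then show "\<not> (of_int j + 1/2 < a k / (1/4) ^ i \<and> a k / (1/4) ^ i < of_int j + 1)"
      unfolding eq using frac_spread_half[of j i N T] by simp
  qed simp
qed

lemma good_scale_exists:
  assumes "l > 0"
  shows "\<exists>r. good_scale r \<and> l / 8 \<le> r \<and> r \<le> l / 2"
proof (cases "l / 2 \<ge> 1")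
  case True
  then show ?thesis using good_scale_ge_1[OF True] assms by (intro exI[of _ "l / 2"]) auto
next
  case False
  define P where "P = (\<lambda>i. (1/4 :: real) ^ i \<le> l / 2)"
  obtain i0 where "(1/4 :: real) ^ i0 < l / 2" using real_arch_pow_inv[of "l / 2" "1/4"] assms by auto
  then have "P i0" by (simp add: P_def)
  \<comment> \<open>The largest power of 1/4 not above \<open>l / 2\<close>; its predecessor exceeds
    \<open>l / 2\<close>, whence the lower bound \<open>l / 8\<close>.\<close>
  define i where "i = (LEAST i. P i)"
  have i: "P i" unfolding i_def by (rule LeastI) fact
  have "i \<noteq> 0" using i False by (cases "i = 0") (auto simp: P_def)
  then obtain i' where i': "i = Suc i'" using not0_implies_Suc by blast
  then have "\<not> P i'" using not_less_Least[of i' P] by (simp add: i_def)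
  then have "l / 8 \<le> (1/4) ^ i" by (simp add: P_def i')
  then show ?thesis using good_scale_power i by (auto simp: P_def)
qed

lemma pts_avoid:
  fixes j :: int
  assumes "good_scale r"
  shows "{(of_int j + 1/2) * r<..<(of_int j + 1) * r} \<inter> pts = {}"
proof -
  let ?J = "{(of_int j + 1/2) * r<..<(of_int j + 1) * r}"
  have "r > 0" using assms by (simp add: good_scale_def)
  have a: "a k \<notin> ?J" for k
  proof
    assume "a k \<in> ?J"
    then have "of_int j + 1/2 < a k / r" "a k / r < of_int j + 1"
      using \<open>r > 0\<close> by (auto simp: pos_less_divide_eq pos_divide_less_eq)
    then show False using assms unfolding good_scale_def by blast
  qed
  have "lim a \<notin> ?J"
  proof
    assume "lim a \<in> ?J"
    \<comment> \<open>The interval is open, so a limit inside it would force points of the sequence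
      inside it.\<close>
    then have "\<forall>\<^sub>F k in sequentially. a k \<in> ?J"
      by (intro topological_tendstoD[OF a_LIMSEQ]) auto
    then obtain k where "a k \<in> ?J"
      using eventually_happens'[OF sequentially_bot] by blast
    then show False using a by blast
  qed
  then show ?thesis using a by (auto simp: pts_def)
qed

text \<open>Any interval contains a full cell of a good grid whose size is at least 1/8 and at most
  1/2 of its length. The right half of the cell is free, which gives the constant 1/16.\<close>

lemma porous_pts: "porous pts"
  unfolding porous_def
proof (intro exI[of _ "1/16"] conjI allI impI)
  fix I :: "real set" assume I: "is_interval I \<and> bounded I \<and> measure lborel I > 0"
  define u where "u = Inf I"
  define v where "v = Sup I"
  have ne: "I \<noteq> {}" using I by auto
  have bdd: "bdd_below I" "bdd_above I" using I bounded_imp_bdd_below bounded_imp_bdd_above by auto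
  have "I \<subseteq> {u..v}" unfolding u_def v_def using bdd by (auto intro: cInf_lower cSup_upper)
  moreover have "I \<in> sets lborel" using I measure_notin_sets by fastforce
  moreover have "u \<le> v" unfolding u_def v_def using cInf_le_cSup[OF ne] bdd by auto
  ultimately have len: "measure lborel I \<le> v - u"
    using measure_mono_fmeasurable[of I "{u..v}" lborel] by (simp add: fmeasurable_def)
  have inner: "{u<..<v} \<subseteq> I"
  proof
    fix x assume "x \<in> {u<..<v}"
    then obtain y z where "y \<in> I" "y < x" "z \<in> I" "x < z"
      unfolding u_def v_def using cInf_less_iff[OF ne bdd(1)] less_cSup_iff[OF ne bdd(2)] by auto
    then show "x \<in> I" using I mem_is_interval_1_I[of I y z x] by auto
  qed
  obtain r where r: "good_scale r" "measure lborel I / 8 \<le> r" "r \<le> measure lborel I / 2"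
    using good_scale_exists I by blast
  have "r > 0" using r(1) by (simp add: good_scale_def)
  \<comment> \<open>The first grid point at or after \<open>u\<close> is
    \<open>of_int j * r\<close>; the cell starting there ends before
    \<open>u + 2 * r \<le> v\<close>.\<close>
  define j where "j = \<lceil>u / r\<rceil>"
  have j: "u / r \<le> of_int j" "of_int j < u / r + 1" unfolding j_def by linarith+
  have j': "u \<le> of_int j * r" "of_int j * r < u + r" using j \<open>r > 0\<close> by (auto simp: field_simps)
  define J where "J = {(of_int j + 1/2) * r<..<(of_int j + 1) * r}"
  have "J \<subseteq> {u<..<v}"
  proof
    fix x assume "x \<in> J"
    then have "of_int j * r + r / 2 < x" "x < of_int j * r + r" by (auto simp: J_def algebra_simps)
    then show "x \<in> {u<..<v}" using j' \<open>r > 0\<close> r(3) len by auto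
  qed
  with inner have "J \<subseteq> I" by blast
  moreover have "measure lborel J = r / 2"
    using \<open>r > 0\<close> by (simp add: J_def algebra_simps)
  ultimately show "\<exists>J. is_interval J \<and> J \<subseteq> I \<and> 1/16 * measure lborel I \<le> measure lborel J \<and> J \<inter> pts = {}"
    using r pts_avoid[OF r(1), of j] by (intro exI[of _ J]) (auto simp: J_def)
qed simp

section \<open>Measure of the neighbourhoods and choice of the scales\<close>

lemma emeasure_nbhd_pts:
  assumes "\<delta> > 0" "unit N \<le> \<delta>"
  shows "emeasure lborel (nbhd pts \<delta>) \<le> ennreal (2 ^ (N + 2) * \<delta>)"
proof -
  \<comment> \<open>\<open>?A\<close> surrounds the points of the blocks before \<open>N\<close>.
    All later points and the limit lie in an interval of length \<open>2 * unit N\<close>, at most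
    \<open>2 * \<delta>\<close>, so the total is at most (2^(N+1) + 2) times
    \<open>\<delta>\<close>.\<close>
  let ?A = "\<Union>k<2 ^ N - 1. ball (a k) \<delta>" and ?B = "{start N - \<delta>..upper N + \<delta>}"
  have "nbhd pts \<delta> \<subseteq> ?A \<union> ?B"
  proof
    fix x assume "x \<in> nbhd pts \<delta>"
    then obtain y where y: "y \<in> pts" "x \<in> ball y \<delta>" by (auto simp: nbhd_def)
    consider "y = lim a" | k where "y = a k" "2 ^ N \<le> Suc k" | k where "y = a k" "k < 2 ^ N - 1"
      using y(1) by (force simp: pts_def)
    then show "x \<in> ?A \<union> ?B"
    proof cases
      case 1
      then show ?thesis using y(2) lim_bounds[of N] by (auto simp: dist_real_def)
    next
      case 2
      then show ?thesis using y(2) a_bounds[of N k] by (auto simp: dist_real_def)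
    qed (use y in auto)
  qed
  then have "emeasure lborel (nbhd pts \<delta>) \<le> emeasure lborel (?A \<union> ?B)"
    by (rule emeasure_mono) auto
  also have "\<dots> \<le> emeasure lborel ?A + emeasure lborel ?B"
    by (rule emeasure_subadditive) auto
  also have "emeasure lborel ?A \<le> (\<Sum>k<2 ^ N - 1. emeasure lborel (ball (a k) \<delta>))"
    by (rule emeasure_subadditive_finite) auto
  also have "\<dots> = (\<Sum>k<2 ^ N - (1::nat). ennreal (2 * \<delta>))"
    using assms by (intro sum.cong) (auto simp: ball_eq_greaterThanLessThan)
  also have "\<dots> = ennreal (real (2 ^ N - 1) * (2 * \<delta>))"
    using assms by (simp add: ennreal_mult ennreal_of_nat_eq_real_of_nat)
  also have "emeasure lborel ?B = ennreal (2 * unit N + 2 * \<delta>)"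
    using assms unit_pos[of N] by (simp add: upper_def)
  also have "ennreal (real (2 ^ N - 1) * (2 * \<delta>)) + ennreal (2 * unit N + 2 * \<delta>)
      = ennreal (real (2 ^ N - 1) * (2 * \<delta>) + (2 * unit N + 2 * \<delta>))"
    using assms unit_pos[of N] by (intro ennreal_plus[symmetric]) auto
  also have "\<dots> \<le> ennreal (2 ^ (N + 2) * \<delta>)"
  proof (rule ennreal_leI)
    have "(1::real) \<le> 2 ^ N" by simp
    from mult_right_mono[OF this less_imp_le[OF \<open>\<delta> > 0\<close>]]
    have "\<delta> \<le> 2 ^ N * \<delta>" by simp
    moreover have "real (2 ^ N - 1) * (2 * \<delta>) = 2 * (2 ^ N * \<delta>) - 2 * \<delta>"
      by (simp add: of_nat_diff algebra_simps)
    moreover have "2 ^ (N + 2) * \<delta> = 4 * (2 ^ N * \<delta>)" by (simp add: power_add)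
    ultimately show "real (2 ^ N - 1) * (2 * \<delta>) + (2 * unit N + 2 * \<delta>) \<le> 2 ^ (N + 2) * \<delta>"
      using assms by linarith
  qed
  finally show ?thesis by (simp add: add_mono)
qed

end

lemma fast_scales_exist:
  assumes "\<And>n::nat. d n > (0::real)"
  shows "\<exists>t. strict_mono t \<and> t 0 \<ge> 1 \<and> (\<forall>n. 1 / 4 ^ t n \<le> d n)"
proof -
  have ex: "\<exists>y>x. 1 / 4 ^ y \<le> d n" for x n
  proof -
    obtain i where i: "(1/4 :: real) ^ i < d n" using real_arch_pow_inv[of "d n" "1/4"] assms by auto
    have "(1/4 :: real) ^ max i (Suc x) \<le> (1/4) ^ i" by (rule power_decreasing) auto
    then show ?thesis using i by (intro exI[of _ "max i (Suc x)"]) (auto simp: power_one_over)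
  qed
  have "\<exists>t. \<forall>n. (t n \<ge> 1 \<and> 1 / 4 ^ t n \<le> d n) \<and> t n < t (Suc n)"
  proof (rule dependent_nat_choice)
    show "\<exists>x\<ge>1. 1 / 4 ^ x \<le> d 0" using ex[of 0 0] by (auto simp: Suc_le_eq)
    show "\<exists>y. (y \<ge> 1 \<and> 1 / 4 ^ y \<le> d (Suc n)) \<and> x < y" if "x \<ge> 1 \<and> 1 / 4 ^ x \<le> d n" for x n
    proof -
      obtain y where "y > x" "1 / 4 ^ y \<le> d (Suc n)" using ex by blast
      then show ?thesis by (intro exI[of _ y]) auto
    qed
  qed
  then show ?thesis by (auto simp: strict_mono_Suc_iff)
qed

theorem theorem3:
  fixes \<delta>0 :: real and \<psi> :: "real \<Rightarrow> real"
  assumes "\<delta>0 > 0"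
    and "\<And>\<delta>. \<delta> \<in> {0<..<\<delta>0} \<Longrightarrow> \<psi> \<delta> > 0"
    and "filterlim (\<lambda>\<delta>. \<psi> \<delta> / \<delta>) at_top (at_right 0)"
  shows "\<exists>a :: nat \<Rightarrow> real. strict_mono a \<and> bounded (range a) \<and>
    (let E = range a \<union> {lim a} in
      porous E \<and>
      (\<forall>\<^sub>F \<delta> in at_right 0. emeasure lborel (nbhd E \<delta>) \<le> ennreal (\<psi> \<delta>)) \<and>
      (\<forall>p::real. 1 < p \<and> p \<noteq> 2 \<longrightarrow> \<not> has_LP p E))"
proof -
  \<comment> \<open>The exponent anticipates the bound for the neighbourhood: when
    \<open>unit (Suc n) \<le> \<delta>\<close>, its measure is at most
    \<open>2 ^ (Suc n + 2) * \<delta>\<close>.\<close>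
  have "\<exists>d>0. \<forall>\<delta>>0. \<delta> < d \<longrightarrow> 2 ^ (n + 3) \<le> \<psi> \<delta> / \<delta>" for n :: nat
    using assms(3) unfolding filterlim_at_top eventually_at_right_field by blast
  then obtain d where d: "\<And>n. d n > 0" "\<And>n \<delta>. 0 < \<delta> \<Longrightarrow> \<delta> < d n \<Longrightarrow> 2 ^ (n + 3) \<le> \<psi> \<delta> / \<delta>"
    by metis
  from fast_scales_exist[of d, OF d(1)] obtain t
    where t: "strict_mono t" "t 0 \<ge> 1" "\<And>n. 1 / 4 ^ t n \<le> d n" by blast
  interpret spread_blocks t by unfold_locales (use t in auto)
  have "\<forall>\<^sub>F \<delta> in at_right 0. emeasure lborel (nbhd pts \<delta>) \<le> ennreal (\<psi> \<delta>)"
    unfolding eventually_at_right_field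
  proof (intro exI[of _ "unit 0"] conjI allI impI unit_pos)
    fix \<delta> assume \<delta>: "0 < \<delta>" "\<delta> < unit 0"
    obtain i where "(1/4 :: real) ^ i < \<delta>" using real_arch_pow_inv[of \<delta> "1/4"] \<delta> by auto
    moreover have "(1/4 :: real) ^ t i \<le> (1/4) ^ i"
      using strict_mono_imp_increasing[OF t(1)] by (intro power_decreasing) auto
    ultimately have ex: "unit i \<le> \<delta>" by (simp add: unit_def power_one_over)
    \<comment> \<open>Minimality gives \<open>\<delta> < unit n'\<close> for the predecessor
      \<open>n'\<close>, and \<open>unit n'\<close> was chosen at most \<open>d n'\<close>.\<close>
    define n where "n = (LEAST n. unit n \<le> \<delta>)"
    have n: "unit n \<le> \<delta>" unfolding n_def by (rule LeastI) fact
    then have "n \<noteq> 0" using \<delta> by (cases "n = 0") auto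
    then obtain n' where n': "n = Suc n'" using not0_implies_Suc by blast
    then have "\<not> unit n' \<le> \<delta>" using not_less_Least[of n' "\<lambda>n. unit n \<le> \<delta>"] by (simp add: n_def)
    then have "2 ^ (n' + 3) \<le> \<psi> \<delta> / \<delta>" using t(3)[of n'] \<delta> by (intro d(2)) (auto simp: unit_def)
    then have "2 ^ (n + 2) * \<delta> \<le> \<psi> \<delta>" using \<delta> by (simp add: n' field_simps power_add)
    then show "emeasure lborel (nbhd pts \<delta>) \<le> ennreal (\<psi> \<delta>)"
      using emeasure_nbhd_pts[OF \<delta>(1) n] ennreal_leI order_trans by blast
  qed
  moreover have "\<not> has_LP p pts" if "1 < p" "p \<noteq> 2" for p
    using spread_gaps_pts step_pos by (intro not_has_LP[OF that]) blast
  ultimately show ?thesis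
    using strict_mono_a bounded_range_a porous_pts unfolding pts_def Let_def by blast
qed

end
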